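(* Let $F$ be the isoperimetric quotient of three-dimensional lattices as a function of the six Selling parameters, and let $\boldsymbol{\rho}_{\mathrm{BCC}}=(1,1,1,1,1,1)$. Then $\boldsymbol{\rho}_{\mathrm{BCC}}$ is a strict local minimiser of $F$ on the hypersurface $$\mathcal{M}=\{\boldsymbol{\rho}\in\mathbb{R}_{\ge 0}^6:\ \det A(\boldsymbol{\rho})=\det A(\boldsymbol{\rho}_{\mathrm{BCC}})=16\},$$ that is, there is a neighbourhood $U$ of $\boldsymbol{\rho}_{\mathrm{BCC}}$ in $\mathbb{R}^6$ such that $F(\boldsymbol{\rho})>F(\boldsymbol{\rho}_{\mathrm{BCC}})$ for all $\boldsymbol{\rho}\in (U\cap\mathcal{M})\setminus\{\boldsymbol{\rho}_{\mathrm{BCC}}\}$. (Equivalently, among lattices sufficiently close to BCC and with the same volume, BCC minimises the scale-invariant quotient $F$.)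
   Context: For $\boldsymbol{\rho}=(\rho_{01},\rho_{02},\rho_{03},\rho_{12},\rho_{13},\rho_{23})=(a,b,c,d,e,f)\in\mathbb{R}_{\ge 0}^6$ (Selling parameters) put $$A(\boldsymbol{\rho})=\begin{pmatrix} a+d+e & -d & -e\\ -d & b+d+f & -f\\ -e & -f & c+e+f\end{pmatrix}.$$ When $\det A(\boldsymbol{\rho})>0$, $A(\boldsymbol{\rho})$ is the Gram matrix of a basis $(b_1,b_2,b_3)$ of a lattice $\Lambda\subset\mathbb{R}^3$ with $\rho_{ij}=-\langle b_i,b_j\rangle$ for $0\le i<j\le 3$, where $b_0=-b_1-b_2-b_3$. The function $F$ is defined for $\boldsymbol{\rho}\in\mathbb{R}_{\ge0}^6$ with $\det A(\boldsymbol{\rho})>0$ by $F(\boldsymbol{\rho})=A_T(\boldsymbol{\rho})/(\det A(\boldsymbol{\rho}))^{1/3}$, where $A_T(\boldsymbol{\rho})$ is the surface area of the Voronoi cell of $\Lambda$ (whose volume is $\sqrt{\det A(\boldsymbol{\rho})}$). Explicitly, $$ \begin{aligned} F(a,b,c,d,e,f)=\frac{2}{(\det A)^{5/6}}\Big(& a f \sqrt{b+c+d+e} + b e \sqrt{a+c+d+f} + c d \sqrt{a+b+e+f} \\ &+ \sqrt{a+b+c}\,(de+df+ef) + \sqrt{a+d+e}\,(bc+bf+cf) \\ &+ \sqrt{b+d+f}\,(ac+ae+ce) + \sqrt{c+e+f}\,(ab+ad+bd)\Big). \end{aligned} $$ The point $\boldsymbol{\rho}_{\mathrm{BCC}}$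 corresponds to the body-centered cubic lattice, whose Voronoi cell is the truncated octahedron. *)

theory Defs
  imports "HOL-Analysis.Analysis"
begin

text \<open>
  The Selling parameters \<open>(a, b, c, d, e, f) = (\<rho>\<^sub>0\<^sub>1, \<rho>\<^sub>0\<^sub>2, \<rho>\<^sub>0\<^sub>3, \<rho>\<^sub>1\<^sub>2, \<rho>\<^sub>1\<^sub>3, \<rho>\<^sub>2\<^sub>3)\<close> are the components
  \<open>\<rho>$1, \<dots>, \<rho>$6\<close> of a vector in \<open>real^6\<close>, in this order.
\<close>

definition selling_matrix :: "real^6 \<Rightarrow> real^3^3" where
  "selling_matrix \<rho> =
    (let a = \<rho>$1; b = \<rho>$2; c = \<rho>$3; d = \<rho>$4; e = \<rho>$5; f = \<rho>$6 in
     vector [vector [a + d + e, - d, - e],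
             vector [- d, b + d + f, - f],
             vector [- e, - f, c + e + f]])"

text \<open>The rows of \<open>B\<close> are the basis vectors.\<close>

definition gram_matrix :: "real^3^3 \<Rightarrow> real^3^3" where
  "gram_matrix B = (\<chi> i j. B$i \<bullet> B$j)"

definition lattice_of :: "real^3^3 \<Rightarrow> (real^3) set" where
  "lattice_of B = range (\<lambda>z::3 \<Rightarrow> int. \<Sum>i\<in>UNIV. of_int (z i) *\<^sub>R B$i)"

definition voronoi_cell :: "(real^3) set \<Rightarrow> (real^3) set" where
  "voronoi_cell \<Lambda> = {x. \<forall>v\<in>\<Lambda>. dist x 0 \<le> dist x v}"

text \<open>
  The area of a planar set in space is the Lebesgue measure of its copy in the Euclidean plane.
  The choice of the isometric embedding \<open>g\<close> is immaterial; the value is meaningful only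
  for sets contained in a plane.
\<close>

definition planar_area :: "(real^3) set \<Rightarrow> real" where
  "planar_area S =
    measure lebesgue
      ((SOME g :: real^2 \<Rightarrow> real^3. (\<forall>x y. dist (g x) (g y) = dist x y) \<and> S \<subseteq> range g) -` S)"

text \<open>The surface area of a three-dimensional convex polytope.\<close>

definition surface_area :: "(real^3) set \<Rightarrow> real" where
  "surface_area P = (\<Sum>S | S facet_of P. planar_area S)"

text \<open>
  A basis with Gram matrix \<open>selling_matrix \<rho>\<close> exists whenever \<open>\<rho>\<close> is nonnegative and the determinant
  is positive, and it is unique up to an orthogonal map, so that the choice does not affect the
  surface area.  For \<open>b\<^sub>0 = - b\<^sub>1 - b\<^sub>2 - b\<^sub>3\<close>, the prescribed Gram matrix is equivalent to
  \<open>\<rho>\<^sub>i\<^sub>j = - (b\<^sub>i \<bullet> b\<^sub>j)\<close> for \<open>0 \<le> i < j \<le> 3\<close>.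
\<close>

definition selling_lattice :: "real^6 \<Rightarrow> (real^3) set" where
  "selling_lattice \<rho> = lattice_of (SOME B. gram_matrix B = selling_matrix \<rho>)"

definition voronoi_area :: "real^6 \<Rightarrow> real" where
  "voronoi_area \<rho> = surface_area (voronoi_cell (selling_lattice \<rho>))"

text \<open>
  The exponent is \<open>1/3\<close> because the volume of the Voronoi cell is the square root of the determinant:
  the quotient is area divided by volume to the power \<open>2/3\<close>.
\<close>

definition isoperimetric_quotient :: "real^6 \<Rightarrow> real" where
  "isoperimetric_quotient \<rho> = voronoi_area \<rho> / det (selling_matrix \<rho>) powr (1/3)"

definition rho_BCC :: "real^6" where
  "rho_BCC = (\<chi> i. 1)"

definition same_volume_hypersurface :: "(real^6) set" where
  "same_volume_hypersurface =
    {\<rho>. (\<forall>i. 0 \<le> \<rho>$i) \<and> det (selling_matrix \<rho>) = det (selling_matrix rho_BCC)}"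

end

theory Submission imports Defs begin

text \<open>
  Near \<open>rho_BCC\<close> the vectors \<open>b\<^sub>0, b\<^sub>1, b\<^sub>2, b\<^sub>3\<close> form an obtuse superbase with strictly negative
  inner products. The Voronoi cell is then cut out by the \<open>14\<close> proper partial sums \<open>v\<close> of the superbase, and
  \<open>v/2\<close> satisfies all the inequalities of the other partial sums strictly, so each of them carries exactly
  one facet. In the coordinates \<open>b\<^sub>j \<bullet> x\<close> the facets are rectangles and hexagons with sides given by the
  Selling parameters, which yields the explicit area formula.

  For the inequality, put \<open>(a, f) = (1 + x\<^sub>1 + v\<^sub>1, 1 + x\<^sub>1 - v\<^sub>1)\<close> and likewise for \<open>(b, e)\<close>, \<open>(c, d)\<close>. By the
  symmetry of the tetrahedron, the second-order part of the Lagrange function is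
  \<open>\<alpha> |x|\<^sup>2 + \<beta> |v|\<^sup>2 + \<gamma> (x\<^sub>1 + x\<^sub>2 + x\<^sub>3)\<^sup>2\<close>, with \<open>\<alpha>, \<beta> > 0\<close>. The determinant constraint makes the last term
  of fourth order. The margin is large enough to replace each square root \<open>sqrt (1 + w)\<close> by
  \<open>1 + w/2 - w\<^sup>2/4\<close>.
\<close>

section \<open>The area function near the symmetric point\<close>

lemma sqrt_one_plus_ge:
  fixes w :: real
  assumes "\<bar>w\<bar> \<le> 1/2"
  shows "1 + w/2 - w\<^sup>2/4 \<le> sqrt (1 + w)"
proof (rule real_le_rsqrt)
  \<comment> \<open>Multiplied by \<open>w\<^sup>2\<close> this is exactly \<open>1 + w\<close>
    minus the square of the left-hand side. The coefficient -1/4, weaker than the Taylor coefficient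
    -1/8, leaves room for the higher-order terms.\<close>
  have "0 \<le> 1/4 + w/4 - w\<^sup>2/16"
    using assms abs_le_square_iff[of w "1/2"] by (simp add: power2_eq_square abs_le_iff)
  then have "0 \<le> w\<^sup>2 * (1/4 + w/4 - w\<^sup>2/16)"
    by simp
  then show "(1 + w/2 - w\<^sup>2/4)\<^sup>2 \<le> 1 + w"
    by (simp add: power2_eq_square algebra_simps)
qed

lemma abs_mult_le_mult:
  fixes x y :: real
  assumes "\<bar>x\<bar> \<le> a" "\<bar>y\<bar> \<le> b"
  shows "\<bar>x * y\<bar> \<le> a * b"
  unfolding abs_mult using assms by (intro mult_mono) auto

text \<open>Bounds a term such as \<open>a*f * sqrt (b+c+d+e)\<close>: with \<open>a = 1+x+v\<close>
  and \<open>f = 1+x-v\<close> the product is \<open>(1+x)\<^sup>2 - v\<^sup>2\<close>, and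
  \<open>w\<close> is the relative change of the radicand 4. Beyond second order only
  \<open>2*(x\<^sup>2-v\<^sup>2)*(w/2-w\<^sup>2/4)\<close> and \<open>- x*w\<^sup>2\<close> remain,
  which \<open>3*(r*N)\<close> dominates.\<close>

lemma opposite_pair_term_ge:
  fixes x v w N r :: real
  assumes r: "\<bar>x\<bar> \<le> r" "\<bar>v\<bar> \<le> r" "\<bar>w\<bar> \<le> r" "r \<le> 1/1000"
    and N: "x\<^sup>2 + v\<^sup>2 \<le> N" "w\<^sup>2 \<le> N"
  shows "2 * (1 + 2*x + w/2 + x\<^sup>2 - v\<^sup>2 + x*w - w\<^sup>2/4) - 3*(r*N)
    \<le> (1 + x + v) * (1 + x - v) * sqrt (4 * (1 + w))"
proof -
  let ?e = "x\<^sup>2 - v\<^sup>2"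
  have "0 \<le> (1 + x + v) * (1 + x - v)"
    using r by (intro mult_nonneg_nonneg) auto
  moreover have "1 + w/2 - w\<^sup>2/4 \<le> sqrt (1 + w)"
    using r by (intro sqrt_one_plus_ge) auto
  ultimately have le: "(1 + x + v) * (1 + x - v) * (2 * (1 + w/2 - w\<^sup>2/4))
      \<le> (1 + x + v) * (1 + x - v) * (2 * sqrt (1 + w))"
    by (intro mult_left_mono) auto
  have e: "\<bar>?e\<bar> \<le> N"
    using N zero_le_power2[of x] zero_le_power2[of v] by linarith
  have r0: "0 \<le> r" using r(1) abs_ge_zero order_trans by blast
  have "w\<^sup>2 \<le> r * r"
    using r(3) by (metis abs_ge_zero abs_mult_self_eq mult_mono order_trans power2_eq_square)
  also have "\<dots> \<le> r * (1/1000)"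
    using r r0 by (intro mult_left_mono) auto
  finally have w2: "w\<^sup>2 \<le> r / 1000" by simp
  have "\<bar>w/2 - w\<^sup>2/4\<bar> \<le> r * (3/5)"
    using r(3) w2 zero_le_power2[of w] by linarith
  then have 1: "\<bar>?e * (w/2 - w\<^sup>2/4)\<bar> \<le> N * (r * (3/5))"
    using e abs_mult_le_mult by blast
  have 2: "\<bar>x * w\<^sup>2\<bar> \<le> r * N"
    using r N by (intro abs_mult_le_mult) auto
  have r4: "sqrt (4 * (1 + w)) = 2 * sqrt (1 + w)"
    by (simp add: real_sqrt_mult del: distrib_left_numeral)
  have "(1 + x + v) * (1 + x - v) * (2 * (1 + w/2 - w\<^sup>2/4)) =
      2 * (1 + 2*x + w/2 + x\<^sup>2 - v\<^sup>2 + x*w - w\<^sup>2/4) + 2 * (?e * (w/2 - w\<^sup>2/4)) - x * w\<^sup>2"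
    by (simp add: power2_eq_square field_simps)
  moreover have "0 \<le> r * N" using 2 by linarith
  ultimately show ?thesis using le 1 2 unfolding r4 by (simp add: mult.commute)
qed

lemma sqrt3_bounds: "17/10 \<le> sqrt 3" "sqrt 3 \<le> 174/100"
  by (rule real_le_rsqrt, simp add: power2_eq_square) (rule real_le_lsqrt, simp_all add: power2_eq_square)

text \<open>Bounds a term such as \<open>sqrt (a+b+c) * (d*e + d*f + e*f)\<close>, where
  \<open>z\<close> is the change of the radicand 3 and the \<open>y\<close>s are the changes of the
  other three parameters. The higher-order terms cost at most \<open>(9/2)*(r*N)\<close> before
  multiplication by \<open>sqrt 3 \<le> 2\<close>.\<close>

lemma vertex_term_ge:
  fixes y1 y2 y3 z N r :: real
  assumes r: "\<bar>z\<bar> \<le> 6*r" "\<bar>y1 + y2 + y3\<bar> \<le> 6*r" "0 \<le> r" "r \<le> 1/1000"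
    and small: "\<bar>y1\<bar> \<le> 1" "\<bar>y2\<bar> \<le> 1" "\<bar>y3\<bar> \<le> 1"
    and N: "y1\<^sup>2 + y2\<^sup>2 + y3\<^sup>2 \<le> 2*N" "z\<^sup>2 \<le> 6*N"
  defines "e \<equiv> y1*y2 + y1*y3 + y2*y3"
  defines "p \<equiv> y1 + y2 + y3"
  shows "sqrt 3 * (3 + 2*p + e + z/2 + z*p/3 - z\<^sup>2/12) - 9*(r*N)
    \<le> sqrt (3 + z) * ((1+y1)*(1+y2) + (1+y1)*(1+y3) + (1+y2)*(1+y3))"
proof -
  let ?E = "(1+y1)*(1+y2) + (1+y1)*(1+y3) + (1+y2)*(1+y3)"
  have E: "?E = 3 + 2*p + e"
    by (simp add: e_def p_def algebra_simps)
  have E0: "0 \<le> ?E"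
    using small by (intro add_nonneg_nonneg[OF add_nonneg_nonneg] mult_nonneg_nonneg) auto
  have "1 + (z/3)/2 - (z/3)\<^sup>2/4 \<le> sqrt (1 + z/3)"
    using r by (intro sqrt_one_plus_ge) auto
  then have le: "?E * (1 + (z/3)/2 - (z/3)\<^sup>2/4) \<le> ?E * sqrt (1 + z/3)"
    using E0 by (intro mult_left_mono)
  have s3: "sqrt (3 + z) = sqrt 3 * sqrt (1 + z/3)"
    by (simp add: real_sqrt_mult[symmetric] algebra_simps)
  have "\<bar>e\<bar> \<le> y1\<^sup>2 + y2\<^sup>2 + y3\<^sup>2"
  proof -
    have "0 \<le> (y1+y2)\<^sup>2 + (y1+y3)\<^sup>2 + (y2+y3)\<^sup>2" "0 \<le> (y1-y2)\<^sup>2 + (y1-y3)\<^sup>2 + (y2-y3)\<^sup>2"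
      by simp_all
    then show ?thesis
      unfolding e_def abs_le_iff by (simp add: power2_eq_square algebra_simps)
  qed
  then have e: "\<bar>e\<bar> \<le> 2*N" using N by linarith
  have N0: "0 \<le> r * N" using e r(3) abs_ge_zero[of e] by (intro mult_nonneg_nonneg) linarith+
  have "z\<^sup>2 \<le> (6*r)*(6*r)"
    using r(1) by (metis abs_ge_zero abs_mult_self_eq mult_mono order_trans power2_eq_square)
  also have "\<dots> \<le> (6*r) * (6 * (1/1000))"
    using r by (intro mult_left_mono) auto
  finally have z2: "z\<^sup>2 \<le> r * (36/1000)" by simp
  have "\<bar>z/6 - z\<^sup>2/36\<bar> \<le> r * (11/10)"
    using r z2 zero_le_power2[of z] by linarith
  then have 1: "\<bar>e * (z/6 - z\<^sup>2/36)\<bar> \<le> (2*N) * (r * (11/10))"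
    using e by (intro abs_mult_le_mult)
  have 2: "\<bar>p * z\<^sup>2\<bar> \<le> (6*r) * (6*N)"
    using r N by (intro abs_mult_le_mult) (auto simp: p_def)
  have "(3 + 2*p + e + z/2 + z*p/3 - z\<^sup>2/12) - (9/2)*(r*N) \<le> ?E * (1 + (z/3)/2 - (z/3)\<^sup>2/4)"
  proof -
    have "?E * (1 + (z/3)/2 - (z/3)\<^sup>2/4) =
        (3 + 2*p + e + z/2 + z*p/3 - z\<^sup>2/12) + e * (z/6 - z\<^sup>2/36) - p * z\<^sup>2 / 18"
      unfolding E by (simp add: power2_eq_square field_simps)
    then show ?thesis using 1 2 N0 by (simp add: mult.commute)
  qed
  then have "sqrt 3 * ((3 + 2*p + e + z/2 + z*p/3 - z\<^sup>2/12) - (9/2)*(r*N)) \<le> sqrt 3 * (?E * sqrt (1 + z/3))"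
    using le by (intro mult_left_mono) auto
  moreover have "sqrt 3 * (r*N) \<le> 2 * (r*N)"
    using N0 sqrt3_bounds by (intro mult_right_mono) auto
  ultimately show ?thesis unfolding s3 by (simp add: algebra_simps)
qed

text \<open>The bracket in the explicit formula for F. Viewing the parameters as the edges of a
  tetrahedron with vertices 0, 1, 2, 3, the first three terms belong to pairs of opposite edges and
  the last four to vertices.\<close>

definition area_sum :: "real \<Rightarrow> real \<Rightarrow> real \<Rightarrow> real \<Rightarrow> real \<Rightarrow> real \<Rightarrow> real" where
  "area_sum a b c d e f =
    a*f * sqrt (b+c+d+e) + b*e * sqrt (a+c+d+f) + c*d * sqrt (a+b+e+f)
    + sqrt (a+b+c) * (d*e + d*f + e*f) + sqrt (a+d+e) * (b*c + b*f + c*f)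
    + sqrt (b+d+f) * (a*c + a*e + c*e) + sqrt (c+e+f) * (a*b + a*d + b*d)"

definition selling_det :: "real \<Rightarrow> real \<Rightarrow> real \<Rightarrow> real \<Rightarrow> real \<Rightarrow> real \<Rightarrow> real" where
  "selling_det a b c d e f =
    (a+d+e) * ((b+d+f) * (c+e+f) - f\<^sup>2) - d * (d * (c+e+f) + e*f) - e * (d*f + e * (b+d+f))"

text \<open>\<open>selling_det\<close> is the spanning-tree polynomial of the complete graph on four
  vertices: 16 cubic monomials with coefficient 1. In each, two factors contribute at most
  \<open>M\<close> and the third at most \<open>r\<close>. The arguments may be negative, since the
  bound is applied to deviations from the symmetric point.\<close>

lemma abs_selling_det_le:
  fixes a b c d e f r M :: real
  assumes "\<And>t. t \<in> {a, b, c, d, e, f} \<Longrightarrow> \<bar>t\<bar> \<le> r"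
    and "\<And>t. t \<in> {a, b, c, d, e, f} \<Longrightarrow> t\<^sup>2 \<le> M"
  shows "\<bar>selling_det a b c d e f\<bar> \<le> 16 * (M * r)"
proof -
  let ?S = "{a, b, c, d, e, f}"
  have prod: "\<bar>p * q * t\<bar> \<le> M * r" if "p \<in> ?S" "q \<in> ?S" "t \<in> ?S" for p q t
  proof (rule abs_mult_le_mult)
    have "p\<^sup>2 \<le> M" "q\<^sup>2 \<le> M" using assms(2) that by blast+
    moreover have "0 \<le> (p + q)\<^sup>2" "0 \<le> (p - q)\<^sup>2" by simp_all
    ultimately show "\<bar>p * q\<bar> \<le> M"
      unfolding abs_le_iff by (simp add: power2_eq_square algebra_simps)
  qed (use assms(1) that in blast)
  have add: "\<bar>p + q\<bar> \<le> m + n" if "\<bar>p\<bar> \<le> m" "\<bar>q\<bar> \<le> n" for p q m n :: real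
    using that by linarith
  have "selling_det a b c d e f =
      a*b*c + a*b*e + a*b*f + a*c*d + a*c*f + a*d*e + a*d*f + a*e*f
      + b*c*d + b*c*e + b*d*e + b*d*f + b*e*f + c*d*e + c*d*f + c*e*f"
    by (simp add: selling_det_def power2_eq_square algebra_simps)
  also have "\<bar>\<dots>\<bar> \<le> M*r + M*r + M*r + M*r + M*r + M*r + M*r + M*r
      + M*r + M*r + M*r + M*r + M*r + M*r + M*r + M*r"
    by (intro add prod) simp_all
  finally show ?thesis by simp
qed

section \<open>The area inequality in symmetrised coordinates\<close>

lemma square_sum2_le: "((p::real) + q)\<^sup>2 \<le> 2 * (p\<^sup>2 + q\<^sup>2)"
  using zero_le_power2[of "p - q"] by (simp add: power2_eq_square algebra_simps)

lemma square_sum3_le: "((p::real) + q + r)\<^sup>2 \<le> 3 * (p\<^sup>2 + q\<^sup>2 + r\<^sup>2)"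
  using zero_le_power2[of "p - q"] zero_le_power2[of "p - r"] zero_le_power2[of "q - r"]
  by (simp add: power2_eq_square algebra_simps)

text \<open>All errors are measured against \<open>N\<close>, half the squared distance to the
  symmetric point. After the constraint is subtracted, a positive multiple of \<open>N\<close>
  outweighs them.\<close>

lemma area_sum_coords_gt:
  fixes x1 x2 x3 v1 v2 v3 :: real
  defines "N \<equiv> x1\<^sup>2 + x2\<^sup>2 + x3\<^sup>2 + v1\<^sup>2 + v2\<^sup>2 + v3\<^sup>2"
  assumes small: "\<bar>x1\<bar> \<le> 1/1000" "\<bar>x2\<bar> \<le> 1/1000" "\<bar>x3\<bar> \<le> 1/1000"
      "\<bar>v1\<bar> \<le> 1/1000" "\<bar>v2\<bar> \<le> 1/1000" "\<bar>v3\<bar> \<le> 1/1000"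
    and det: "selling_det (1+x1+v1) (1+x2+v2) (1+x3+v3) (1+x3-v3) (1+x2-v2) (1+x1-v1) = 16"
    and N: "0 < N"
  shows "6 + 12 * sqrt 3 <
    area_sum (1+x1+v1) (1+x2+v2) (1+x3+v3) (1+x3-v3) (1+x2-v2) (1+x1-v1)"
proof -
  define s where "s = x1 + x2 + x3"
  define X where "X = x1\<^sup>2 + x2\<^sup>2 + x3\<^sup>2"
  define V where "V = v1\<^sup>2 + v2\<^sup>2 + v3\<^sup>2"
  define R where "R = selling_det (x1+v1) (x2+v2) (x3+v3) (x3-v3) (x2-v2) (x1-v1)"
  have N_eq: "N = X + V" by (simp add: N_def X_def V_def)
  note bnd = small[THEN abs_le_D1] small[THEN abs_le_D2]
  have sq: "0 \<le> x1\<^sup>2" "0 \<le> x2\<^sup>2" "0 \<le> x3\<^sup>2" "0 \<le> v1\<^sup>2" "0 \<le> v2\<^sup>2" "0 \<le> v3\<^sup>2"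
    by simp_all
  have X0: "0 \<le> X" and V0: "0 \<le> V" using sq by (simp_all add: X_def V_def)
  \<comment> \<open>Taylor expansion of the determinant at the symmetric point. As the determinant
    is a homogeneous cubic, the third-order part \<open>R\<close> is the same polynomial evaluated
    at the deviations.\<close>
  have det_exp: "16 * s + 6 * s\<^sup>2 - 2 * X - 4 * V + R = 0"
    using det unfolding R_def s_def X_def V_def selling_det_def
    by (simp add: power2_eq_square algebra_simps)
  have two: "(p + q)\<^sup>2 \<le> 2 * N" "(p - q)\<^sup>2 \<le> 2 * N" if "p\<^sup>2 + q\<^sup>2 \<le> N" for p q
    using that square_sum2_le[of p q] square_sum2_le[of p "-q"] by simp_all
  have pairs: "x1\<^sup>2 + v1\<^sup>2 \<le> N" "x2\<^sup>2 + v2\<^sup>2 \<le> N" "x3\<^sup>2 + v3\<^sup>2 \<le> N"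
      "x2\<^sup>2 + x3\<^sup>2 \<le> N" "x1\<^sup>2 + x3\<^sup>2 \<le> N" "x1\<^sup>2 + x2\<^sup>2 \<le> N"
    unfolding N_def using sq by linarith+
  have R: "\<bar>R\<bar> \<le> 16 * ((2*N) * (2/1000))"
    unfolding R_def
  proof (rule abs_selling_det_le)
    have le: "\<bar>x1+v1\<bar> \<le> 2/1000" "\<bar>x2+v2\<bar> \<le> 2/1000" "\<bar>x3+v3\<bar> \<le> 2/1000"
        "\<bar>x3-v3\<bar> \<le> 2/1000" "\<bar>x2-v2\<bar> \<le> 2/1000" "\<bar>x1-v1\<bar> \<le> 2/1000"
      using bnd by linarith+
    fix t assume t: "t \<in> {x1+v1, x2+v2, x3+v3, x3-v3, x2-v2, x1-v1}"
    then show "\<bar>t\<bar> \<le> 2/1000" using le by blast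
    show "t\<^sup>2 \<le> 2 * N" using t two pairs by blast
  qed
  have s3: "s\<^sup>2 \<le> 3 * X"
    unfolding s_def X_def by (rule square_sum3_le)
  have s1: "\<bar>s\<bar> \<le> 3/1000" unfolding s_def using bnd by linarith
  \<comment> \<open>The constraint expresses the linear term \<open>16 * s\<close> through terms of
    order at least two, so \<open>s\<close> is itself of second order. Below,
    \<open>s\<^sup>2\<close> thus costs only a small multiple of \<open>N\<close>.\<close>
  have "\<bar>s\<bar> \<le> 2 * N"
    using det_exp s3 R X0 V0 N_eq zero_le_power2[of s] by linarith
  then have "\<bar>s * s\<bar> \<le> (3/1000) * (2*N)"
    using s1 by (intro abs_mult_le_mult) auto
  then have s2: "s\<^sup>2 \<le> N * (6/1000)" by (simp add: power2_eq_square)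
  have mean: "((p + q)/2)\<^sup>2 \<le> N" if "p\<^sup>2 + q\<^sup>2 \<le> N" for p q
    using two(1)[OF that] N by (simp add: power_divide)
  note opp = opposite_pair_term_ge[where N = N and r = "1/1000"]
  have o1: "2 * (1 + 2*x1 + ((x2+x3)/2)/2 + x1\<^sup>2 - v1\<^sup>2 + x1*((x2+x3)/2) - ((x2+x3)/2)\<^sup>2/4) - 3*(1/1000*N)
      \<le> (1+x1+v1) * (1+x1-v1) * sqrt (4 * (1 + (x2+x3)/2))"
    using bnd by (intro opp mean pairs abs_leI) simp_all
  have o2: "2 * (1 + 2*x2 + ((x1+x3)/2)/2 + x2\<^sup>2 - v2\<^sup>2 + x2*((x1+x3)/2) - ((x1+x3)/2)\<^sup>2/4) - 3*(1/1000*N)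
      \<le> (1+x2+v2) * (1+x2-v2) * sqrt (4 * (1 + (x1+x3)/2))"
    using bnd by (intro opp mean pairs abs_leI) simp_all
  have o3: "2 * (1 + 2*x3 + ((x1+x2)/2)/2 + x3\<^sup>2 - v3\<^sup>2 + x3*((x1+x2)/2) - ((x1+x2)/2)\<^sup>2/4) - 3*(1/1000*N)
      \<le> (1+x3+v3) * (1+x3-v3) * sqrt (4 * (1 + (x1+x2)/2))"
    using bnd by (intro opp mean pairs abs_leI) simp_all
  \<comment> \<open>The four vertex terms differ only in the signs of the \<open>v\<close>s: vertex
    0 has \<open>(v1, v2, v3)\<close>, and each other vertex flips two of the signs. The parameters
    not meeting the vertex carry the opposite signs, hence \<open>x - w\<close>.\<close>
  have vert: "sqrt 3 * (3 + 2 * (s - (w1+w2+w3)) + ((x3-w3)*(x2-w2) + (x3-w3)*(x1-w1) + (x2-w2)*(x1-w1))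
        + (s+w1+w2+w3)/2 + (s+w1+w2+w3)*(s-(w1+w2+w3))/3 - (s+w1+w2+w3)\<^sup>2/12) - 9*(1/1000*N)
      \<le> sqrt (3 + (s+w1+w2+w3)) * ((1+(x3-w3))*(1+(x2-w2)) + (1+(x3-w3))*(1+(x1-w1)) + (1+(x2-w2))*(1+(x1-w1)))"
    if w: "\<bar>w1\<bar> = \<bar>v1\<bar>" "\<bar>w2\<bar> = \<bar>v2\<bar>" "\<bar>w3\<bar> = \<bar>v3\<bar>" for w1 w2 w3
  proof -
    have ww: "w1\<^sup>2 = v1\<^sup>2" "w2\<^sup>2 = v2\<^sup>2" "w3\<^sup>2 = v3\<^sup>2" using w by (simp_all add: power2_eq_iff abs_eq_iff)
    have p: "s - (w1+w2+w3) = (x3-w3) + (x2-w2) + (x1-w1)" by (simp add: s_def)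
    have "(w1+w2+w3)\<^sup>2 \<le> 3 * V"
      using square_sum3_le[of w1 w2 w3] by (simp add: V_def ww)
    then have z: "(s+w1+w2+w3)\<^sup>2 \<le> 6 * N"
      using square_sum2_le[of s "w1+w2+w3"] s3 N_eq by (simp add: add.assoc)
    have y: "(x3-w3)\<^sup>2 + (x2-w2)\<^sup>2 + (x1-w1)\<^sup>2 \<le> 2 * N"
      using square_sum2_le[of x1 "-w1"] square_sum2_le[of x2 "-w2"] square_sum2_le[of x3 "-w3"] ww
      unfolding N_def by simp
    have wb: "\<bar>w1\<bar> \<le> 1/1000" "\<bar>w2\<bar> \<le> 1/1000" "\<bar>w3\<bar> \<le> 1/1000"
      using w small by simp_all
    note wb = wb[THEN abs_le_D1] wb[THEN abs_le_D2]
    show ?thesis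
      unfolding p by (intro vertex_term_ge z y abs_leI) (use bnd wb s_def in linarith)+
  qed
  define t where "t = sqrt 3"
  have t: "17/10 \<le> t" "t \<le> 174/100" using sqrt3_bounds by (simp_all add: t_def)
  define W where "W w1 w2 w3 = sqrt (3 + (s+w1+w2+w3))
      * ((1+(x3-w3))*(1+(x2-w2)) + (1+(x3-w3))*(1+(x1-w1)) + (1+(x2-w2))*(1+(x1-w1)))" for w1 w2 w3
  define B where "B w1 w2 w3 = 3 + 2 * (s - (w1+w2+w3))
      + ((x3-w3)*(x2-w2) + (x3-w3)*(x1-w1) + (x2-w2)*(x1-w1))
      + (s+w1+w2+w3)/2 + (s+w1+w2+w3)*(s-(w1+w2+w3))/3 - (s+w1+w2+w3)\<^sup>2/12" for w1 w2 w3
  have vert': "t * B w1 w2 w3 - 9*(1/1000*N) \<le> W w1 w2 w3"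
    if "\<bar>w1\<bar> = \<bar>v1\<bar>" "\<bar>w2\<bar> = \<bar>v2\<bar>" "\<bar>w3\<bar> = \<bar>v3\<bar>" for w1 w2 w3
    using vert[OF that] unfolding t_def B_def W_def .
  let ?area = "area_sum (1+x1+v1) (1+x2+v2) (1+x3+v3) (1+x3-v3) (1+x2-v2) (1+x1-v1)"
  have quad: "4 * (1 + (p+q)/2) = 4 + 2*p + 2*q" for p q :: real
    by (simp add: field_simps)
  have area: "?area = (1+x1+v1) * (1+x1-v1) * sqrt (4 * (1 + (x2+x3)/2))
      + (1+x2+v2) * (1+x2-v2) * sqrt (4 * (1 + (x1+x3)/2))
      + (1+x3+v3) * (1+x3-v3) * sqrt (4 * (1 + (x1+x2)/2))
      + (W v1 v2 v3 + W v1 (-v2) (-v3) + W (-v1) v2 (-v3) + W (-v1) (-v2) v3)"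
    unfolding quad by (simp add: area_sum_def W_def s_def algebra_simps)
  \<comment> \<open>Over the four sign patterns the terms linear in the \<open>v\<close>s and the
    mixed products of different \<open>v\<close>s cancel, leaving only \<open>s\<close>,
    \<open>X\<close> and \<open>V\<close>.\<close>
  have B: "B v1 v2 v3 + B v1 (-v2) (-v3) + B (-v1) v2 (-v3) + B (-v1) (-v2) v3
      = 12 + 10 * s + 3 * s\<^sup>2 - 2 * X - 5/3 * V"
    by (simp add: B_def s_def X_def V_def power2_eq_square field_simps)
  have O: "2 * (1 + 2*x1 + ((x2+x3)/2)/2 + x1\<^sup>2 - v1\<^sup>2 + x1*((x2+x3)/2) - ((x2+x3)/2)\<^sup>2/4)
      + 2 * (1 + 2*x2 + ((x1+x3)/2)/2 + x2\<^sup>2 - v2\<^sup>2 + x2*((x1+x3)/2) - ((x1+x3)/2)\<^sup>2/4)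
      + 2 * (1 + 2*x3 + ((x1+x2)/2)/2 + x3\<^sup>2 - v3\<^sup>2 + x3*((x1+x2)/2) - ((x1+x2)/2)\<^sup>2/4)
      = 6 + 5 * s + 7/8 * s\<^sup>2 + 7/8 * X - 2 * V"
    by (simp add: s_def X_def V_def power2_eq_square field_simps)
  \<comment> \<open>The loss is 3/1000 \<open>N\<close> for each of three opposite pairs and 9/1000
    \<open>N\<close> for each of four vertices.\<close>
  have "6 + 5 * s + 7/8 * s\<^sup>2 + 7/8 * X - 2 * V
      + t * (12 + 10 * s + 3 * s\<^sup>2 - 2 * X - 5/3 * V) - 45/1000*N \<le> ?area"
    unfolding area O[symmetric] B[symmetric]
    using o1 o2 o3 vert'[of v1 v2 v3] vert'[of v1 "-v2" "-v3"] vert'[of "-v1" v2 "-v3"]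
      vert'[of "-v1" "-v2" v3] by (simp add: distrib_left)
  \<comment> \<open>Lagrange multiplier: the determinant constraint is subtracted with the weight that
    cancels the linear term in \<open>s\<close>.\<close>
  moreover have "(5 + 10*t)/16 * (16 * s + 6 * s\<^sup>2 - 2 * X - 4 * V + R) = 0"
    unfolding det_exp by simp
  ultimately have "6 + 12 * t + ((3/2 - 3/4*t) * X + (5/6*t - 3/4) * V - (1 + 3/4*t) * s\<^sup>2
      - (5 + 10*t)/16 * R - 45/1000*N) \<le> ?area"
    by (simp add: field_simps)
  moreover have "0 < (3/2 - 3/4*t) * X + (5/6*t - 3/4) * V - (1 + 3/4*t) * s\<^sup>2
      - (5 + 10*t)/16 * R - 45/1000*N"
  proof -
    \<comment> \<open>195/1000 is the coefficient of \<open>X\<close> at the upper bound 174/100 for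
      \<open>sqrt 3\<close>. Against it stand 15/1000 from \<open>s\<^sup>2\<close>, 90/1000 from
      \<open>R\<close> and 45/1000 from the term bounds, so 45/1000 \<open>N\<close>
      remains.\<close>
    have "(195/1000) * X \<le> (3/2 - 3/4*t) * X" "(195/1000) * V \<le> (5/6*t - 3/4) * V"
      using t X0 V0 by (intro mult_right_mono; linarith)+
    moreover have "(1 + 3/4*t) * s\<^sup>2 \<le> (5/2) * (N * (6/1000))"
      using t s2 by (intro mult_mono) auto
    moreover have "(5 + 10*t)/16 * R \<le> (225/160) * (16 * ((2*N) * (2/1000)))"
      using t R by (intro abs_le_D1[OF abs_mult_le_mult]) auto
    ultimately show ?thesis using N N_eq by linarith
  qed
  ultimately show ?thesis
    unfolding t_def[symmetric] by (meson less_add_same_cancel1 order_less_le_trans)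
qed

lemma area_sum_gt:
  fixes a b c d e f :: real
  assumes near: "\<bar>a - 1\<bar> \<le> 1/1000" "\<bar>b - 1\<bar> \<le> 1/1000" "\<bar>c - 1\<bar> \<le> 1/1000"
      "\<bar>d - 1\<bar> \<le> 1/1000" "\<bar>e - 1\<bar> \<le> 1/1000" "\<bar>f - 1\<bar> \<le> 1/1000"
    and det: "selling_det a b c d e f = 16"
    and ne: "\<not> (a = 1 \<and> b = 1 \<and> c = 1 \<and> d = 1 \<and> e = 1 \<and> f = 1)"
  shows "6 + 12 * sqrt 3 < area_sum a b c d e f"
proof -
  let ?x1 = "(a+f)/2 - 1" and ?x2 = "(b+e)/2 - 1" and ?x3 = "(c+d)/2 - 1"
  let ?v1 = "(a-f)/2" and ?v2 = "(b-e)/2" and ?v3 = "(c-d)/2"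
  have eqs: "1 + ?x1 + ?v1 = a" "1 + ?x2 + ?v2 = b" "1 + ?x3 + ?v3 = c"
      "1 + ?x3 - ?v3 = d" "1 + ?x2 - ?v2 = e" "1 + ?x1 - ?v1 = f"
    by (simp_all add: field_simps)
  have "\<bar>(p+q)/2 - 1\<bar> \<le> 1/1000" "\<bar>(p-q)/2\<bar> \<le> 1/1000" if "\<bar>p - 1\<bar> \<le> 1/1000" "\<bar>q - 1\<bar> \<le> 1/1000"
    for p q :: real
    using that[THEN abs_le_D1] that[THEN abs_le_D2] by (intro abs_leI; simp)+
  note small = this(1)[OF near(1) near(6)] this(1)[OF near(2) near(5)] this(1)[OF near(3) near(4)]
    this(2)[OF near(1) near(6)] this(2)[OF near(2) near(5)] this(2)[OF near(3) near(4)]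
  have "\<not> (?x1 = 0 \<and> ?x2 = 0 \<and> ?x3 = 0 \<and> ?v1 = 0 \<and> ?v2 = 0 \<and> ?v3 = 0)"
    using ne by (auto simp: field_simps)
  then have "0 < ?x1\<^sup>2 + ?x2\<^sup>2 + ?x3\<^sup>2 + ?v1\<^sup>2 + ?v2\<^sup>2 + ?v3\<^sup>2"
    by (auto simp: add_nonneg_eq_0_iff less_le)
  from area_sum_coords_gt[OF small _ this] show ?thesis
    unfolding eqs using det by blast
qed

section \<open>Areas of planar sets\<close>

text \<open>Shows that the choice in \<open>planar_area\<close> can be met: the orthogonal
  complement of \<open>v\<close> is two-dimensional, so the Euclidean plane maps isometrically onto
  it, and the multiple \<open>(c / (v \<bullet> v)) *\<^sub>R v\<close> translates it to the given
  plane.\<close>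

lemma isometry_to_hyperplane:
  fixes v :: "real^3"
  assumes "v \<noteq> 0"
  shows "\<exists>g :: real^2 \<Rightarrow> real^3. (\<forall>x y. dist (g x) (g y) = dist x y) \<and> {x. v \<bullet> x = c} \<subseteq> range g"
proof -
  let ?T = "{x. v \<bullet> x = 0}"
  have T: "subspace ?T" "dim ?T = 2"
    using assms by (simp_all add: subspace_hyperplane dim_hyperplane)
  have "dim (UNIV :: (real^2) set) \<le> dim ?T" using T by simp
  then obtain f :: "real^2 \<Rightarrow> real^3" where f: "linear f" "f \<in> UNIV \<rightarrow> ?T" "\<And>x. norm (f x) = norm x"
    using isometry_subset_subspace[OF subspace_UNIV T(1)] by (metis UNIV_I)
  have inj: "inj f"
    unfolding linear_injective_0[OF f(1)]
  proof (intro allI impI)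
    show "x = 0" if "f x = 0" for x using f(3)[of x] that by simp
  qed
  have "range f = ?T"
  proof (rule subspace_dim_equal)
    show "subspace (range f)" using f(1) by (simp add: linear_subspace_image subspace_UNIV)
    show "dim ?T \<le> dim (range f)" using T(2) inj f(1) by (simp add: dim_image_eq)
  qed (use T f(2) in auto)
  let ?p = "(c / (v \<bullet> v)) *\<^sub>R v"
  have on: "x \<in> range (\<lambda>y. ?p + f y)" if "v \<bullet> x = c" for x
  proof -
    have "x - ?p \<in> ?T" using that assms by (simp add: inner_diff_right)
    then obtain y where "x - ?p = f y" using \<open>range f = ?T\<close> by blast
    then have "x = ?p + f y" by (simp add: algebra_simps)
    then show ?thesis by blast
  qed
  have "dist (?p + f x) (?p + f y) = dist x y" for x y
    by (simp add: dist_norm f(3) flip: linear_diff[OF f(1)])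
  then show ?thesis
    using on by (intro exI[of _ "\<lambda>y. ?p + f y"]) auto
qed

text \<open>After translation to fix the origin, norms and distances are preserved, hence inner
  products by polarisation. The defects of additivity and homogeneity then have inner product 0 with
  themselves.\<close>

lemma dist_preserving_imp_affine:
  fixes g :: "'a::real_inner \<Rightarrow> 'b::real_inner"
  assumes "\<And>x y. dist (g x) (g y) = dist x y"
  shows "linear (\<lambda>x. g x - g 0)" "(g x - g 0) \<bullet> (g y - g 0) = x \<bullet> y"
proof -
  define f where "f x = g x - g 0" for x
  have n: "norm (f x - f y) = norm (x - y)" for x y
    using assms[of x y] by (simp add: f_def dist_norm)
  have n0: "norm (f x) = norm x" for x
    using n[of x 0] by (simp add: f_def)
  have ip: "f x \<bullet> f y = x \<bullet> y" for x y
    using n[of x y] n0[of x] n0[of y] unfolding norm_eq_sqrt_inner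
    by (simp add: inner_diff_left inner_diff_right inner_commute)
  show "(g x - g 0) \<bullet> (g y - g 0) = x \<bullet> y" using ip by (simp add: f_def)
  have "linear f"
  proof
    fix x y :: 'a and r :: real
    have "(f (x + y) - f x - f y) \<bullet> (f (x + y) - f x - f y) = 0"
      by (simp add: inner_diff_left inner_diff_right ip inner_add_left inner_add_right)
    then have "f (x + y) - f x - f y = 0" by (simp only: inner_eq_zero_iff)
    then show "f (x + y) = f x + f y" by (simp add: algebra_simps)
    have "(f (r *\<^sub>R x) - r *\<^sub>R f x) \<bullet> (f (r *\<^sub>R x) - r *\<^sub>R f x) = 0"
      by (simp add: inner_diff_left inner_diff_right ip)
    then have "f (r *\<^sub>R x) - r *\<^sub>R f x = 0" by (simp only: inner_eq_zero_iff)
    then show "f (r *\<^sub>R x) = r *\<^sub>R f x" by simp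
  qed
  then show "linear (\<lambda>x. g x - g 0)" by (simp add: f_def[abs_def])
qed

text \<open>The left side is the Jacobian of
  \<open>x \<mapsto> (u \<bullet> x, w \<bullet> x)\<close> on the plane orthogonal to
  \<open>v\<close>. Multiplying the matrix by the transpose of the orthogonal \<open>?Q\<close> with
  rows \<open>v / norm v, e1, e2\<close> keeps the absolute determinant and turns the first row into
  \<open>(norm v, 0, 0)\<close>.\<close>

lemma abs_det_inner_orthonormal_pair:
  fixes v u w e1 e2 :: "real^3"
  assumes v: "v \<noteq> 0" "v \<bullet> e1 = 0" "v \<bullet> e2 = 0"
    and e: "e1 \<bullet> e1 = 1" "e2 \<bullet> e2 = 1" "e1 \<bullet> e2 = 0"
  shows "\<bar>(e1 \<bullet> u) * (e2 \<bullet> w) - (e2 \<bullet> u) * (e1 \<bullet> w)\<bar> = \<bar>det (vector [v, u, w] :: real^3^3)\<bar> / norm v"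
proof -
  let ?n = "v /\<^sub>R norm v"
  let ?Q = "vector [?n, e1, e2] :: real^3^3"
  have "norm ?n = 1" using v(1) by simp
  moreover have "norm e1 = 1" "norm e2 = 1" using e by (simp_all add: norm_eq_1)
  moreover have "row 1 ?Q = ?n" "row 2 ?Q = e1" "row 3 ?Q = e2"
    by (simp_all add: row_def vec_eq_iff)
  moreover have "e1 \<bullet> v = 0" "e2 \<bullet> v = 0" "e2 \<bullet> e1 = 0"
    using v e by (simp_all add: inner_commute)
  ultimately have "orthogonal_matrix ?Q"
    unfolding orthogonal_matrix_orthonormal_rows forall_3
    using v e by (simp add: orthogonal_def del: norm_scaleR)
  then have "\<bar>det ?Q\<bar> = 1" using det_orthogonal_matrix by fastforce
  then have "\<bar>det (vector [v, u, w] :: real^3^3)\<bar> = \<bar>det ((vector [v, u, w] :: real^3^3) ** transpose ?Q)\<bar>"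
    by (simp add: det_mul abs_mult)
  also have "(vector [v, u, w] :: real^3^3) ** transpose ?Q =
      vector [vector [v \<bullet> ?n, v \<bullet> e1, v \<bullet> e2], vector [u \<bullet> ?n, u \<bullet> e1, u \<bullet> e2], vector [w \<bullet> ?n, w \<bullet> e1, w \<bullet> e2]]"
    by (simp add: vec_eq_iff forall_3 matrix_matrix_mult_def transpose_def inner_vec_def vector_3 sum_3)
  also have "\<bar>det \<dots>\<bar> = norm v * \<bar>(e1 \<bullet> u) * (e2 \<bullet> w) - (e2 \<bullet> u) * (e1 \<bullet> w)\<bar>"
  proof -
    have "v \<bullet> ?n = norm v" using v by (simp add: dot_square_norm power2_eq_square)
    moreover have "det (vector [vector [k, v \<bullet> e1, v \<bullet> e2], vector [u \<bullet> ?n, u \<bullet> e1, u \<bullet> e2],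
        vector [w \<bullet> ?n, w \<bullet> e1, w \<bullet> e2]] :: real^3^3) = k * ((e1 \<bullet> u) * (e2 \<bullet> w) - (e2 \<bullet> u) * (e1 \<bullet> w))" for k
      using v by (simp add: det_3 vector_3 inner_commute algebra_simps)
    ultimately show ?thesis by (simp add: abs_mult)
  qed
  finally show ?thesis using v by simp
qed

text \<open>The coordinates \<open>u \<bullet> x\<close> and \<open>w \<bullet> x\<close> scale area
  in the plane by the constant Jacobian \<open>\<bar>det\<bar> / norm v\<close>. This replaces the
  unknown isometry of \<open>planar_area\<close> by coordinates in which facets are simple
  polygons.\<close>

lemma planar_area_eq:
  fixes S :: "(real^3) set" and u v w :: "real^3"
  assumes S: "compact S" "S \<subseteq> {x. v \<bullet> x = c}" "aff_dim S = 2"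
    and det: "det (vector [v, u, w] :: real^3^3) \<noteq> 0"
  shows "planar_area S = norm v / \<bar>det (vector [v, u, w] :: real^3^3)\<bar>
    * measure lebesgue ((\<lambda>x. vector [u \<bullet> x, w \<bullet> x] :: real^2) ` S)"
proof -
  have v0: "v \<noteq> 0"
    using det by (auto simp: det_3 vector_3)
  define g :: "real^2 \<Rightarrow> real^3"
    where "g = (SOME g. (\<forall>x y. dist (g x) (g y) = dist x y) \<and> S \<subseteq> range g)"
  have "\<exists>g :: real^2 \<Rightarrow> real^3. (\<forall>x y. dist (g x) (g y) = dist x y) \<and> S \<subseteq> range g"
    using isometry_to_hyperplane[OF v0, of c] order_trans[OF S(2)] by blast
  then have g: "\<And>x y. dist (g x) (g y) = dist x y" "S \<subseteq> range g"
    using someI_ex[of "\<lambda>g. (\<forall>x y. dist (g x) (g y) = dist x y) \<and> S \<subseteq> range g"] unfolding g_def by blast+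
  define f where "f x = g x - g 0" for x
  have f: "linear f" "\<And>x y. f x \<bullet> f y = x \<bullet> y"
    using dist_preserving_imp_affine[of g] g(1) by (simp_all add: f_def[abs_def])
  have affine: "affine (range g)" "aff_dim (range g) = 2"
  proof -
    have r: "range g = (+) (g 0) ` range f" by (auto simp: f_def image_image image_iff)
    have "inj f"
      unfolding linear_injective_0[OF f(1)]
    proof (intro allI impI)
      show "x = 0" if "f x = 0" for x using f(2)[of x x] that by simp
    qed
    then show "affine (range g)" "aff_dim (range g) = 2"
      unfolding r using f(1)
      by (simp_all add: affine_translation[symmetric] subspace_imp_affine linear_subspace_image
          aff_dim_translation_eq aff_dim_injective_linear_image)
  qed
  \<comment> \<open>The chosen \<open>g\<close> is only known to cover \<open>S\<close>. Since
    \<open>S\<close> has dimension 2, it determines the whole plane \<open>range g\<close>, so the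
    linear part of \<open>g\<close> is orthogonal to \<open>v\<close>.\<close>
  have "affine hull S = range g"
    using S g affine by (intro affine_dim_equal) (auto simp: hull_minimal)
  moreover have "affine hull S \<subseteq> {x. v \<bullet> x = c}"
    using S(2) by (simp add: hull_minimal affine_hyperplane)
  ultimately have "v \<bullet> g x = c" for x by blast
  then have vf: "v \<bullet> f x = 0" for x by (simp add: f_def inner_diff_right)
  define h where "h x = (vector [u \<bullet> f x, w \<bullet> f x] :: real^2)" for x
  have h: "linear h"
    using f(1) unfolding h_def
    by (intro linearI) (simp_all add: vec_eq_iff forall_2 vector_2 linear_add linear_cmul inner_add_right)
  have meas: "g -` S \<in> lmeasurable"
  proof (intro lmeasurable_compact)
    have "continuous_on UNIV (\<lambda>x. g 0 + f x)"
      using f(1) by (intro continuous_intros linear_continuous_on) (simp add: linear_conv_bounded_linear)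
    then have "continuous_on UNIV g" by (simp add: f_def)
    then have "closed (g -` S)"
      using S(1) by (simp add: closed_vimage compact_imp_closed)
    moreover have "bounded (g -` S)"
    proof -
      obtain B where "\<forall>y\<in>S. dist (g 0) y \<le> B"
        using compact_imp_bounded[OF S(1)] bounded_any_center[of S "g 0"] by blast
      then have "\<forall>x\<in>g -` S. dist (g 0) (g x) \<le> B" by simp
      then have "\<forall>x\<in>g -` S. dist 0 x \<le> B" unfolding g(1) .
      then show ?thesis unfolding bounded_def by blast
    qed
    ultimately show "compact (g -` S)" by (simp add: compact_eq_bounded_closed)
  qed
  have "(\<lambda>x. vector [u \<bullet> x, w \<bullet> x] :: real^2) ` S = (\<lambda>x. vector [u \<bullet> x, w \<bullet> x]) ` g ` (g -` S)"
    using g(2) by (simp add: image_vimage_eq Int_absorb2)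
  also have "\<dots> = (+) (vector [u \<bullet> g 0, w \<bullet> g 0]) ` h ` (g -` S)"
    unfolding image_image
    by (intro image_cong) (simp_all add: h_def f_def vec_eq_iff forall_2 vector_2 inner_diff_right)
  finally have "measure lebesgue ((\<lambda>x. vector [u \<bullet> x, w \<bullet> x] :: real^2) ` S) = measure lebesgue (h ` (g -` S))"
    by (simp add: measure_translation)
  also have "\<dots> = \<bar>det (matrix h)\<bar> * measure lebesgue (g -` S)"
    by (rule measure_linear_image[OF h meas])
  also have "\<bar>det (matrix h)\<bar> = \<bar>det (vector [v, u, w] :: real^3^3)\<bar> / norm v"
  proof -
    have "det (matrix h) = (u \<bullet> f (axis 1 1)) * (w \<bullet> f (axis 2 1)) - (u \<bullet> f (axis 2 1)) * (w \<bullet> f (axis 1 1))"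
      by (simp add: det_2 matrix_def h_def vector_2)
    also have "\<dots> = (f (axis 1 1) \<bullet> u) * (f (axis 2 1) \<bullet> w) - (f (axis 2 1) \<bullet> u) * (f (axis 1 1) \<bullet> w)"
      by (simp only: inner_commute[of u] inner_commute[of w])
    finally show ?thesis
      by (simp only:) (rule abs_det_inner_orthonormal_pair, simp_all only: v0 vf f(2) inner_axis_axis, simp_all)
  qed
  finally show ?thesis
    using det v0 unfolding planar_area_def g_def[symmetric] by simp
qed

section \<open>Areas of rectangles and centrally symmetric hexagons\<close>

lemma measure_rectangle:
  fixes s t x y :: real
  assumes "0 \<le> s" "0 \<le> t"
  shows "measure lebesgue {z :: real^2. x \<le> z$1 \<and> z$1 \<le> x + s \<and> y \<le> z$2 \<and> z$2 \<le> y + t} = s * t"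
proof -
  have eq: "{z :: real^2. x \<le> z$1 \<and> z$1 \<le> x + s \<and> y \<le> z$2 \<and> z$2 \<le> y + t} =
      cbox (vector [x, y]) (vector [x + s, y + t])"
    by (auto simp: mem_box_cart forall_2)
  have "(vector [x, y] :: real^2) \<in> cbox (vector [x, y]) (vector [x + s, y + t])"
    using assms by (auto simp: mem_box_cart forall_2)
  then have "cbox (vector [x, y] :: real^2) (vector [x + s, y + t]) \<noteq> {}" by blast
  then show ?thesis
    unfolding eq by (simp add: content_cbox_cart UNIV_2)
qed

text \<open>A right isosceles triangle with legs \<open>p\<close> and its right angle at
  \<open>\<sigma> * (s, t)\<close>. The sign \<open>\<sigma>\<close> covers two opposite corners of
  a rectangle at once.\<close>

lemma corner_triangle:
  fixes \<sigma> s t p :: real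
  assumes "\<sigma> = 1 \<or> \<sigma> = -1" "0 < p"
  defines "T \<equiv> {z :: real^2. \<sigma> * z$1 \<le> s \<and> \<sigma> * z$2 \<le> t \<and> s + t - p \<le> \<sigma> * (z$1 + z$2)}"
  shows "measure lebesgue T = p\<^sup>2 / 2" "T \<in> lmeasurable"
proof -
  let ?A = "vector [\<sigma> * s, \<sigma> * t] :: real^2" and ?B = "vector [\<sigma> * s, \<sigma> * (t - p)] :: real^2"
    and ?C = "vector [\<sigma> * (s - p), \<sigma> * t] :: real^2"
  have \<sigma>: "\<sigma> * \<sigma> = 1" using assms(1) by auto
  have T: "T = convex hull {?A, ?B, ?C}"
  proof (rule set_eqI)
    fix z :: "real^2"
    have "z \<in> convex hull {?A, ?B, ?C} \<longleftrightarrow>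
        (\<exists>u v. z = ?A + u *\<^sub>R (?B - ?A) + v *\<^sub>R (?C - ?A) \<and> 0 \<le> u \<and> 0 \<le> v \<and> u + v \<le> 1)"
      unfolding convex_hull_3_alt by blast
    also have "\<dots> \<longleftrightarrow> (\<exists>u v. z$1 = \<sigma> * (s - v * p) \<and> z$2 = \<sigma> * (t - u * p) \<and> 0 \<le> u \<and> 0 \<le> v \<and> u + v \<le> 1)"
      by (simp add: vec_eq_iff forall_2 algebra_simps)
    also have "\<dots> \<longleftrightarrow> z \<in> T"
    proof
      assume "\<exists>u v. z$1 = \<sigma> * (s - v * p) \<and> z$2 = \<sigma> * (t - u * p) \<and> 0 \<le> u \<and> 0 \<le> v \<and> u + v \<le> 1"
      then obtain u v where uv: "z$1 = \<sigma> * (s - v * p)" "z$2 = \<sigma> * (t - u * p)" "0 \<le> u" "0 \<le> v" "u + v \<le> 1"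
        by blast
      have "\<sigma> * z$1 = s - v * p" "\<sigma> * z$2 = t - u * p"
        unfolding uv(1,2) mult.assoc[symmetric] \<sigma> by simp_all
      moreover have "(u + v) * p \<le> 1 * p" using uv assms(2) by (intro mult_right_mono) auto
      ultimately show "z \<in> T"
        using uv(3,4) assms(2) by (simp add: T_def distrib_left[of \<sigma>] distrib_right)
    next
      assume z: "z \<in> T"
      let ?u = "(t - \<sigma> * z$2) / p" and ?v = "(s - \<sigma> * z$1) / p"
      have "z$1 = \<sigma> * (s - ?v * p)" "z$2 = \<sigma> * (t - ?u * p)"
        using assms(2) \<sigma> by (simp_all flip: mult.assoc)
      moreover have "?u + ?v \<le> 1"
        using z assms(2) by (simp add: T_def distrib_left flip: add_divide_distrib)
      moreover have "0 \<le> ?u" "0 \<le> ?v" using z assms(2) by (simp_all add: T_def)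
      ultimately show "\<exists>u v. z$1 = \<sigma> * (s - v * p) \<and> z$2 = \<sigma> * (t - u * p) \<and> 0 \<le> u \<and> 0 \<le> v \<and> u + v \<le> 1"
        by blast
    qed
    finally show "z \<in> T \<longleftrightarrow> z \<in> convex hull {?A, ?B, ?C}" by simp
  qed
  have c: "compact (convex hull {?A, ?B, ?C})" by (intro finite_imp_compact_convex_hull) simp
  then show "T \<in> lmeasurable" unfolding T by (rule lmeasurable_compact)
  have "measure lebesgue T = measure lborel (convex hull {?A, ?B, ?C})"
    unfolding T using c by (intro measure_completion) (auto dest: compact_imp_closed)
  also have "\<dots> = p\<^sup>2 / 2"
    unfolding content_triangle using assms(1) by (auto simp: algebra_simps power2_eq_square)
  finally show "measure lebesgue T = p\<^sup>2 / 2" .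
qed

text \<open>The hexagon is a rectangle with sides \<open>p+q\<close> and \<open>p+r\<close> from
  which two opposite corner triangles with legs \<open>p\<close> are cut:
  \<open>(p+q)*(p+r) - p\<^sup>2\<close>.\<close>

lemma measure_hexagon:
  fixes p q r :: real
  assumes "0 < p" "0 < q" "0 < r"
  shows "measure lebesgue {z :: real^2. \<bar>z$1\<bar> \<le> (p+q)/2 \<and> \<bar>z$2\<bar> \<le> (p+r)/2 \<and> \<bar>z$1 + z$2\<bar> \<le> (q+r)/2}
    = p*q + p*r + q*r" (is "measure lebesgue ?H = _")
proof -
  let ?T = "\<lambda>\<sigma>. {z :: real^2. \<sigma> * z$1 \<le> (p+q)/2 \<and> \<sigma> * z$2 \<le> (p+r)/2 \<and>
    (p+q)/2 + (p+r)/2 - p \<le> \<sigma> * (z$1 + z$2)}"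
  let ?R = "{z :: real^2. -(p+q)/2 \<le> z$1 \<and> z$1 \<le> -(p+q)/2 + (p+q) \<and> -(p+r)/2 \<le> z$2 \<and> z$2 \<le> -(p+r)/2 + (p+r)}"
  have k: "(p+q)/2 + (p+r)/2 - p = (q+r)/2" by (simp add: field_simps)
  have neg: "negligible {z :: real^2. z$1 + z$2 = c}" for c
  proof -
    have "(vector [1, 1] :: real^2) \<noteq> 0" by (simp add: vec_eq_iff forall_2)
    then have "negligible {z :: real^2. vector [1, 1] \<bullet> z = c}" by (intro negligible_hyperplane) simp
    then show ?thesis by (simp add: inner_vec_def UNIV_2)
  qed
  have "measure lebesgue ?R = measure lebesgue ?H + measure lebesgue (?T 1) + measure lebesgue (?T (-1))"
  proof (rule measure_Un3_negligible)
    have H: "?H = cbox (vector [-(p+q)/2, -(p+r)/2]) (vector [(p+q)/2, (p+r)/2]) \<inter> {z. \<bar>z$1 + z$2\<bar> \<le> (q+r)/2}"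
      by (auto simp: mem_box_cart forall_2)
    have "closed {z :: real^2. \<bar>z$1 + z$2\<bar> \<le> (q+r)/2}"
      by (intro closed_Collect_le continuous_intros)
    then show "?H \<in> lmeasurable"
      unfolding H by (rule lmeasurable_compact[OF compact_Int_closed[OF compact_cbox]])
    show "?T 1 \<in> lmeasurable" "?T (-1) \<in> lmeasurable"
      using corner_triangle(2) assms by blast+
    have "z$1 + z$2 = (q+r)/2" if "z \<in> ?H \<inter> ?T 1" for z
    proof (rule order.antisym)
      show "z$1 + z$2 \<le> (q+r)/2" using that by (blast dest: abs_le_D1)
      show "(q+r)/2 \<le> z$1 + z$2" using that unfolding k by simp
    qed
    then show "negligible (?H \<inter> ?T 1)"
      by (intro negligible_subset[OF neg[of "(q+r)/2"]]) blast
    have "z$1 + z$2 = - ((q+r)/2)" if "z \<in> ?H \<inter> ?T (-1)" for z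
    proof (rule order.antisym)
      show "z$1 + z$2 \<le> - ((q+r)/2)" using that unfolding k by (auto simp: field_simps)
      have "- (z$1 + z$2) \<le> (q+r)/2" using that by (blast dest: abs_le_D2)
      then show "- ((q+r)/2) \<le> z$1 + z$2" by (simp add: field_simps)
    qed
    then show "negligible (?H \<inter> ?T (-1))"
      by (intro negligible_subset[OF neg[of "- ((q+r)/2)"]]) blast
    show "negligible (?T 1 \<inter> ?T (-1))" unfolding k
      by (rule negligible_subset[OF neg[of 0]], intro subsetI, use assms in simp)
    \<comment> \<open>The two conditions on \<open>C\<close> keep the corner triangles inside the
      rectangle: \<open>C \<le> s + t\<close> and \<open>t \<le> B\<close> give
      \<open>s \<ge> C - B \<ge> - A\<close>, and likewise for \<open>t\<close>.\<close>
    have "\<bar>s\<bar> \<le> A \<and> \<bar>t\<bar> \<le> B \<and> \<bar>s + t\<bar> \<le> C \<or> s \<le> A \<and> t \<le> B \<and> C \<le> s + t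
        \<or> - s \<le> A \<and> - t \<le> B \<and> C \<le> - (s + t) \<longleftrightarrow> - A \<le> s \<and> s \<le> A \<and> - B \<le> t \<and> t \<le> B"
      if "B - A \<le> C" "A - B \<le> C" for s t A B C :: real
      using that by (auto simp: abs_le_iff)
    note cover = this[of "(p+r)/2" "(p+q)/2" "(q+r)/2"]
    have half: "- (c/2) + c = c/2" for c :: real by simp
    show "?H \<union> ?T 1 \<union> ?T (-1) = ?R"
      unfolding k set_eq_iff Un_iff mem_Collect_eq disj_assoc mult_1 mult_minus1 half minus_divide_left[symmetric]
      by (intro allI cover) (use assms in \<open>simp_all add: field_simps\<close>)
  qed
  moreover have "measure lebesgue ?R = (p+q) * (p+r)"
    using assms by (intro measure_rectangle) auto
  moreover have "measure lebesgue (?T 1) = p\<^sup>2 / 2" "measure lebesgue (?T (-1)) = p\<^sup>2 / 2"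
    using corner_triangle(1) assms(1) by blast+
  ultimately have "measure lebesgue ?H = (p+q) * (p+r) - p\<^sup>2 / 2 - p\<^sup>2 / 2"
    by linarith
  then show ?thesis by (simp add: power2_eq_square algebra_simps)
qed

section \<open>Facets of bisector polytopes and obtuse superbases\<close>

lemma mem_voronoi_cell_iff: "x \<in> voronoi_cell \<Lambda> \<longleftrightarrow> (\<forall>v\<in>\<Lambda>. v \<bullet> x \<le> v \<bullet> v / 2)"
proof -
  have "dist x 0 \<le> dist x v \<longleftrightarrow> v \<bullet> x \<le> v \<bullet> v / 2" for v
    by (auto simp: dist_norm norm_le inner_diff_left inner_diff_right inner_commute)
  then show ?thesis by (simp add: voronoi_cell_def)
qed

text \<open>By \<open>sep\<close>, the midpoint \<open>v/2\<close> lies strictly inside the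
  half-space of every other \<open>w\<close>. Hence no half-space is redundant, and the facets of an
  irredundantly described polyhedron correspond to its half-spaces.\<close>

lemma surface_area_bisector_polytope:
  fixes V :: "(real^3) set"
  assumes V: "finite V" "0 \<notin> V"
    and sep: "\<And>v w. v \<in> V \<Longrightarrow> w \<in> V \<Longrightarrow> v \<noteq> w \<Longrightarrow> w \<bullet> v < w \<bullet> w"
  defines "P \<equiv> {x. \<forall>v\<in>V. v \<bullet> x \<le> v \<bullet> v / 2}"
  shows "surface_area P = (\<Sum>v\<in>V. planar_area (P \<inter> {x. v \<bullet> x = v \<bullet> v / 2}))"
    and "v \<in> V \<Longrightarrow> aff_dim (P \<inter> {x. v \<bullet> x = v \<bullet> v / 2}) = 2"
proof -
  define H where "H v = {x. v \<bullet> x \<le> v \<bullet> v / 2}" for v :: "real^3"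
  have pos: "0 < v \<bullet> v" if "v \<in> V" for v using V(2) that by auto
  have beyond: "\<exists>x. v \<bullet> v / 2 < v \<bullet> x \<and> (\<forall>w\<in>V - {v}. w \<bullet> x \<le> w \<bullet> w / 2)" if v: "v \<in> V" for v
  proof -
    \<comment> \<open>The witness is \<open>t *\<^sub>R v\<close> with \<open>t\<close> slightly
      above 1/2: it crosses the bisector of \<open>v\<close> but, by continuity, no other.\<close>
    have "\<forall>\<^sub>F t in at_right (1/2). t * (w \<bullet> v) < w \<bullet> w / 2" if "w \<in> V - {v}" for w
    proof (rule order_tendstoD(2))
      show "((\<lambda>t. t * (w \<bullet> v)) \<longlongrightarrow> 1/2 * (w \<bullet> v)) (at_right (1/2))"
        by (intro tendsto_intros)
      show "1/2 * (w \<bullet> v) < w \<bullet> w / 2" using sep[of v w] v that by auto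
    qed
    then have "\<forall>\<^sub>F t in at_right (1/2). \<forall>w\<in>V - {v}. t * (w \<bullet> v) < w \<bullet> w / 2"
      using V(1) by (intro eventually_ball_finite) auto
    moreover have "\<forall>\<^sub>F t in at_right (1/2 :: real). 1/2 < t" by (rule eventually_at_right_less)
    ultimately have "\<forall>\<^sub>F t in at_right (1/2). 1/2 < t \<and> (\<forall>w\<in>V - {v}. t * (w \<bullet> v) < w \<bullet> w / 2)"
      by eventually_elim simp
    then obtain t :: real where t: "1/2 < t" "\<forall>w\<in>V - {v}. t * (w \<bullet> v) < w \<bullet> w / 2"
      using eventually_happens'[OF trivial_limit_at_right_real] by blast
    have "1/2 * (v \<bullet> v) < t * (v \<bullet> v)" using t(1) pos[OF v] by (rule mult_strict_right_mono)
    then show ?thesis using t(2) by (intro exI[of _ "t *\<^sub>R v"]) (auto simp: less_imp_le)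
  qed
  have inj: "inj_on H V"
  proof (rule inj_onI, rule ccontr)
    fix v w assume vw: "v \<in> V" "w \<in> V" "H v = H w" "v \<noteq> w"
    obtain x where "v \<bullet> v / 2 < v \<bullet> x" "\<forall>w\<in>V - {v}. w \<bullet> x \<le> w \<bullet> w / 2"
      using beyond[OF vw(1)] by blast
    then have "x \<in> H w" "x \<notin> H v" using vw(2,4) by (auto simp: H_def)
    then show False using vw(3) by blast
  qed
  have P: "P = \<Inter>(H ` V)" by (auto simp: P_def H_def)
  have "affine hull P = UNIV"
  proof (rule affine_hull_nonempty_interior)
    let ?U = "\<Inter>v\<in>V. {x. v \<bullet> x < v \<bullet> v / 2}"
    have "open ?U" using V(1) by (intro open_INT ballI open_halfspace_lt)
    moreover have "?U \<subseteq> P" by (auto simp: P_def less_imp_le)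
    moreover have "0 \<in> ?U" using pos by auto
    ultimately show "interior P \<noteq> {}" using interior_maximal by blast
  qed
  then have aff3: "aff_dim P = 3" using aff_dim_affine_hull[of P] by simp
  \<comment> \<open>The description of facets is indexed by half-spaces; \<open>a\<close> recovers
    the normal vector from its half-space.\<close>
  define a where "a = the_inv_into V H"
  have a: "a (H v) = v" if "v \<in> V" for v
    unfolding a_def using inj that by (rule the_inv_into_f_f)
  have facets: "C facet_of P \<longleftrightarrow> (\<exists>h. h \<in> H ` V \<and> C = P \<inter> {x. a h \<bullet> x = a h \<bullet> a h / 2})" for C
  proof (rule facet_of_polyhedron_explicit)
    show "finite (H ` V)" using V(1) by simp
    show "P = affine hull P \<inter> \<Inter>(H ` V)" using \<open>affine hull P = UNIV\<close> P by simp
    show "a h \<noteq> 0 \<and> h = {x. a h \<bullet> x \<le> a h \<bullet> a h / 2}" if "h \<in> H ` V" for h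
      using that a V(2) by (auto simp: H_def)
    fix F' assume F': "F' \<subset> H ` V"
    then obtain v where v: "v \<in> V" "H v \<notin> F'" by blast
    obtain x where x: "v \<bullet> v / 2 < v \<bullet> x" "\<forall>w\<in>V - {v}. w \<bullet> x \<le> w \<bullet> w / 2"
      using beyond[OF v(1)] by blast
    have "x \<in> \<Inter>F'"
    proof
      fix h assume "h \<in> F'"
      then obtain w where "w \<in> V" "h = H w" "w \<noteq> v" using F' v(2) by blast
      then show "x \<in> h" using x(2) by (simp add: H_def)
    qed
    moreover have "x \<notin> P" using x(1) v(1) by (force simp: P_def)
    moreover have "P \<subseteq> \<Inter>F'" using P F' by blast
    ultimately show "P \<subset> affine hull P \<inter> \<Inter>F'"
      using \<open>affine hull P = UNIV\<close> by blast
  qed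
  let ?C = "\<lambda>v. P \<inter> {x. v \<bullet> x = v \<bullet> v / 2}"
  have "{C. C facet_of P} = ?C ` V"
    unfolding facets using a by auto
  moreover have "inj_on ?C V"
  proof (rule inj_onI, rule ccontr)
    fix v w assume vw: "v \<in> V" "w \<in> V" "?C v = ?C w" "v \<noteq> w"
    \<comment> \<open>Different vectors give different facets: \<open>v/2\<close> lies on the facet
      of \<open>v\<close>, but strictly inside the half-space of \<open>w\<close>.\<close>
    have "u \<bullet> (v /\<^sub>R 2) \<le> u \<bullet> u / 2" if "u \<in> V" for u
      using sep[OF vw(1) that] by (cases "u = v") auto
    then have "v /\<^sub>R 2 \<in> ?C v" by (simp add: P_def)
    then have "w \<bullet> (v /\<^sub>R 2) = w \<bullet> w / 2" using vw(3) by blast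
    then show False using sep[OF vw(1,2,4)] by simp
  qed
  ultimately show "surface_area P = (\<Sum>v\<in>V. planar_area (?C v))"
    unfolding surface_area_def by (simp add: sum.reindex)
  show "aff_dim (?C v) = 2" if "v \<in> V"
  proof -
    have "?C v facet_of P"
      unfolding facets using that a by (intro exI[of _ "H v"]) simp
    then show ?thesis using aff3 by (simp add: facet_of_def)
  qed
qed

section \<open>Obtuse superbases and the half-spaces of their partial sums\<close>

locale obtuse_superbase =
  fixes I :: "'i set" and b :: "'i \<Rightarrow> 'a::euclidean_space"
  assumes finite_index: "finite I"
    and sum_eq_0: "sum b I = 0"
    and obtuse: "\<And>i j. i \<in> I \<Longrightarrow> j \<in> I \<Longrightarrow> i \<noteq> j \<Longrightarrow> b i \<bullet> b j < 0"
begin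

lemma inner_sum_disjoint_neg:
  assumes "S \<subseteq> I" "T \<subseteq> I" "S \<inter> T = {}" "S \<noteq> {}" "T \<noteq> {}"
  shows "sum b S \<bullet> sum b T < 0"
proof -
  have fin: "finite S" "finite T" using assms finite_index finite_subset by blast+
  have "0 < - (b i \<bullet> b j)" if "i \<in> S" "j \<in> T" for i j
  proof -
    have "i \<noteq> j" using that assms(3) by blast
    then show ?thesis using obtuse[of i j] that assms by auto
  qed
  then have "0 < (\<Sum>i\<in>S. \<Sum>j\<in>T. - (b i \<bullet> b j))"
    by (intro sum_pos fin assms(4,5))
  then show ?thesis by (subst inner_sum_left) (simp add: inner_sum_right sum_negf)
qed

lemma sum_complement: "T \<subseteq> I \<Longrightarrow> sum b T = - sum b (I - T)"
  using sum.subset_diff[of T I b] finite_index sum_eq_0 by (simp add: add_eq_0_iff)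

text \<open>Replacing \<open>sum b T\<close> by minus the sum over the complement reduces this to
  disjoint index sets.\<close>

lemma inner_sum_subset_pos:
  assumes "S \<subseteq> T" "T \<subset> I" "S \<noteq> {}"
  shows "0 < sum b S \<bullet> sum b T"
  using inner_sum_disjoint_neg[of S "I - T"] sum_complement[of T] assms by auto

lemma inner_sum_subset_nonneg:
  assumes "S \<subseteq> T" "T \<subseteq> I"
  shows "0 \<le> sum b S \<bullet> sum b T"
proof (cases "S = {} \<or> T = I")
  case True
  then show ?thesis by (auto simp: sum_eq_0)
next
  case False
  then show ?thesis using inner_sum_subset_pos assms by (simp add: psubset_eq less_imp_le)
qed

text \<open>The difference of the two sums is \<open>sum b (T - S) - sum b (S - T)\<close>. Paired
  with \<open>sum b T\<close>, the first part is nonnegative and the second nonpositive, and one of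
  them is strict because \<open>S \<noteq> T\<close>. This is the separation condition that gives
  every partial sum its own facet.\<close>

lemma inner_sum_less:
  assumes "S \<subseteq> I" "T \<subset> I" "T \<noteq> {}" "S \<noteq> T"
  shows "sum b T \<bullet> sum b S < sum b T \<bullet> sum b T"
proof -
  have fin: "finite S" "finite T" using assms finite_index finite_subset by blast+
  have "sum b T - sum b S = sum b (T - S) - sum b (S - T)"
    using sum.Int_Diff[OF fin(1), of b T] sum.Int_Diff[OF fin(2), of b S] by (simp add: Int_commute)
  then have eq: "sum b T \<bullet> sum b T - sum b T \<bullet> sum b S
      = sum b (T - S) \<bullet> sum b T - sum b (S - T) \<bullet> sum b T"
    by (metis inner_commute inner_diff_left)
  have 1: "0 \<le> sum b (T - S) \<bullet> sum b T"
    using assms by (intro inner_sum_subset_nonneg) auto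
  have 2: "sum b (S - T) \<bullet> sum b T \<le> 0"
  proof (cases "S - T = {}")
    case True
    then show ?thesis by (simp only: sum.empty inner_zero_left order_refl)
  next
    case False
    then show ?thesis using assms by (intro less_imp_le inner_sum_disjoint_neg) auto
  qed
  consider "T - S \<noteq> {}" | "S - T \<noteq> {}" using assms(4) by blast
  then show ?thesis
  proof cases
    case 1
    then have "0 < sum b (T - S) \<bullet> sum b T" using assms by (intro inner_sum_subset_pos) auto
    then show ?thesis using eq 2 by linarith
  next
    case 2
    then have "sum b (S - T) \<bullet> sum b T < 0" using assms by (intro inner_sum_disjoint_neg) auto
    then show ?thesis using eq 1 by linarith
  qed
qed

text \<open>The finite description of the Voronoi cell; \<open>voronoi_cell_eq_cell\<close>
  identifies the two in dimension three.\<close>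

definition cell :: "'a set" where
  "cell = {x. \<forall>v \<in> sum b ` (Pow I - {{}, I}). v \<bullet> x \<le> v \<bullet> v / 2}"

text \<open>Induction by peeling off the support \<open>S\<close> of the coefficient vector: the cross term with \<open>sum b S\<close>
  is nonnegative because \<open>b i \<bullet> sum b S \<ge> 0\<close> for \<open>i \<in> S\<close>.\<close>
lemma cell_bound_nat:
  fixes m :: "'i \<Rightarrow> nat"
  assumes x: "x \<in> cell"
  shows "(\<Sum>i\<in>I. real (m i) *\<^sub>R b i) \<bullet> x \<le> (\<Sum>i\<in>I. real (m i) *\<^sub>R b i) \<bullet> (\<Sum>i\<in>I. real (m i) *\<^sub>R b i) / 2"
proof (induction "sum m I" arbitrary: m rule: less_induct)
  case less
  define S where "S = {i \<in> I. 0 < m i}"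
  \<comment> \<open>Truncated subtraction: coefficients on \<open>S\<close> drop by one and the
    others stay 0, so the vector loses exactly \<open>sum b S\<close>.\<close>
  define m' where "m' i = m i - 1" for i
  let ?v = "\<lambda>m. \<Sum>i\<in>I. real (m i) *\<^sub>R b i"
  show ?case
  proof (cases "S = {}")
    case True
    then have "?v m = 0" by (intro sum.neutral) (auto simp: S_def)
    then show ?thesis by simp
  next
    case False
    have "sum m' I < sum m I"
      using False finite_index by (intro sum_strict_mono_ex1) (force simp: m'_def S_def)+
    then have IH: "?v m' \<bullet> x \<le> ?v m' \<bullet> ?v m' / 2" by (rule less)
    have "?v m = (\<Sum>i\<in>I. real (m' i) *\<^sub>R b i + (if i \<in> S then b i else 0))"
    proof (rule sum.cong)
      fix i assume "i \<in> I"
      show "real (m i) *\<^sub>R b i = real (m' i) *\<^sub>R b i + (if i \<in> S then b i else 0)"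
      proof (cases "m i")
        case (Suc n)
        then show ?thesis using \<open>i \<in> I\<close> by (simp add: S_def m'_def algebra_simps)
      qed (simp add: S_def m'_def)
    qed simp
    also have "\<dots> = ?v m' + sum b S"
      using finite_index by (simp add: sum.distrib sum.If_cases S_def Int_def)
    finally have v: "?v m = ?v m' + sum b S" .
    have "sum b S \<bullet> x \<le> sum b S \<bullet> sum b S / 2"
    proof (cases "S = I")
      case True
      then show ?thesis by (simp add: sum_eq_0)
    next
      case f: False
      have "S \<in> Pow I - {{}, I}" using False f by (auto simp: S_def)
      then show ?thesis using x by (simp add: cell_def)
    qed
    moreover have "0 \<le> ?v m' \<bullet> sum b S"
      unfolding inner_sum_left
    proof (rule sum_nonneg)
      fix i assume "i \<in> I"
      show "0 \<le> (real (m' i) *\<^sub>R b i) \<bullet> sum b S"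
      proof (cases "i \<in> S")
        case True
        then have "0 \<le> sum b {i} \<bullet> sum b S" by (intro inner_sum_subset_nonneg) (auto simp: S_def)
        then show ?thesis by simp
      next
        case False
        then show ?thesis using \<open>i \<in> I\<close> by (simp add: S_def m'_def)
      qed
    qed
    ultimately show ?thesis
      using IH unfolding v by (simp add: inner_add_left inner_add_right inner_commute)
  qed
qed

text \<open>Adding a constant \<open>N\<close> to all coefficients leaves the vector unchanged
  because the superbase sums to 0. A large \<open>N\<close> makes all coefficients
  nonnegative.\<close>

lemma cell_bound_int:
  fixes m :: "'i \<Rightarrow> int"
  assumes x: "x \<in> cell"
  shows "(\<Sum>i\<in>I. of_int (m i) *\<^sub>R b i) \<bullet> x \<le> (\<Sum>i\<in>I. of_int (m i) *\<^sub>R b i) \<bullet> (\<Sum>i\<in>I. of_int (m i) *\<^sub>R b i) / 2"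
proof -
  define N where "N = (\<Sum>i\<in>I. \<bar>m i\<bar>)"
  have N: "0 \<le> m i + N" if "i \<in> I" for i
    using member_le_sum[of i I "\<lambda>i. \<bar>m i\<bar>"] finite_index that by (simp add: N_def)
  have "(\<Sum>i\<in>I. real (nat (m i + N)) *\<^sub>R b i) = (\<Sum>i\<in>I. of_int (m i) *\<^sub>R b i + of_int N *\<^sub>R b i)"
    using N by (intro sum.cong) (simp_all add: scaleR_left_distrib)
  also have "\<dots> = (\<Sum>i\<in>I. of_int (m i) *\<^sub>R b i)"
    using sum_eq_0 by (simp add: sum.distrib flip: scaleR_sum_right)
  finally show ?thesis using cell_bound_nat[OF x, of "\<lambda>i. nat (m i + N)"] by simp
qed

lemma inj_on_sum: "inj_on (sum b) (Pow I - {{}, I})"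
proof (rule inj_onI, rule ccontr)
  fix S T assume "S \<in> Pow I - {{}, I}" "T \<in> Pow I - {{}, I}" "sum b S = sum b T" "S \<noteq> T"
  then show False using inner_sum_less[of S T] by auto
qed

end

section \<open>Three-dimensional Voronoi cells\<close>

lemma inner_eqs_solvable:
  fixes p q r :: "real^3"
  assumes "det (vector [p, q, r] :: real^3^3) \<noteq> 0"
  shows "\<exists>x. p \<bullet> x = \<alpha> \<and> q \<bullet> x = \<beta> \<and> r \<bullet> x = \<gamma>"
proof -
  let ?M = "vector [p, q, r] :: real^3^3"
  obtain N where "?M ** N = mat 1" using assms by (auto simp: invertible_det_nz[symmetric] invertible_def)
  let ?x = "N *v vector [\<alpha>, \<beta>, \<gamma>]"
  have "?M *v ?x = vector [\<alpha>, \<beta>, \<gamma>]"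
    by (simp add: matrix_vector_mul_assoc \<open>?M ** N = mat 1\<close>)
  then have "(?M *v ?x) $ n = vector [\<alpha>, \<beta>, \<gamma>] $ n" for n by simp
  from this[of 1] this[of 2] this[of 3] show ?thesis
    unfolding matrix_vector_mul_component by (intro exI[of _ ?x]) simp
qed

lemma bounded_if_inner_bounded:
  fixes p q r :: "real^3" and S :: "(real^3) set"
  assumes det: "det (vector [p, q, r] :: real^3^3) \<noteq> 0"
    and bd: "\<And>x. x \<in> S \<Longrightarrow> \<bar>p \<bullet> x\<bar> \<le> c \<and> \<bar>q \<bullet> x\<bar> \<le> c \<and> \<bar>r \<bullet> x\<bar> \<le> c"
  shows "bounded S"
proof -
  let ?M = "vector [p, q, r] :: real^3^3"
  obtain N where N: "N ** ?M = mat 1" using det by (auto simp: invertible_det_nz[symmetric] invertible_def)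
  let ?B = "cbox (\<chi> n. - c) (\<chi> n. c) :: (real^3) set"
  have "x \<in> (*v) (N) ` ?B" if "x \<in> S" for x
  proof
    show "x = N *v (?M *v x)"
      by (simp add: matrix_vector_mul_assoc N)
    show "?M *v x \<in> ?B"
      using bd[OF that] by (simp add: mem_box_cart forall_3 matrix_vector_mul_component abs_le_iff)
  qed
  moreover have "bounded ((*v) (N) ` ?B)"
    by (intro bounded_linear_image bounded_cbox matrix_vector_mul_bounded_linear)
  ultimately show ?thesis using bounded_subset by blast
qed

section \<open>The fourteen facets of the cell of a three-dimensional superbase\<close>

lemma double_abs_le_iff: "2 * \<bar>t\<bar> \<le> c \<longleftrightarrow> 2 * t \<le> c \<and> - (2 * t) \<le> c" for t c :: real
  using abs_le_iff[of "2 * t" c] by (simp only: abs_mult abs_numeral)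

lemma abs_le_half_iff: "\<bar>t\<bar> \<le> c / 2 \<longleftrightarrow> 2 * t \<le> c \<and> - (2 * t) \<le> c" for t c :: real
  unfolding double_abs_le_iff[symmetric] by (simp add: mult.commute)

text \<open>The coordinates \<open>- u\<close> and \<open>- w\<close> on the reflected set have the
  same image as \<open>u\<close> and \<open>w\<close> on \<open>S\<close>, and the determinant
  changes only its sign.\<close>

lemma planar_area_uminus:
  fixes S :: "(real^3) set" and u v w :: "real^3"
  assumes S: "compact S" "S \<subseteq> {x. v \<bullet> x = c}" "aff_dim S = 2"
    and det: "det (vector [v, u, w] :: real^3^3) \<noteq> 0"
  shows "planar_area (uminus ` S) = planar_area S"
proof -
  have d: "det (vector [- v, - u, - w] :: real^3^3) = - det (vector [v, u, w] :: real^3^3)"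
    by (simp add: det_3)
  have "aff_dim (uminus ` S) = 2"
    using S(3) aff_dim_injective_linear_image[of "uminus :: real^3 \<Rightarrow> real^3" S]
    by (simp add: inj_on_def linear_uminus)
  moreover have "compact (uminus ` S)"
    using S(1) by (rule compact_negations)
  moreover have "uminus ` S \<subseteq> {x. - v \<bullet> x = c}" using S(2) by auto
  ultimately have "planar_area (uminus ` S) = norm (- v) / \<bar>det (vector [- v, - u, - w] :: real^3^3)\<bar>
      * measure lebesgue ((\<lambda>x. vector [- u \<bullet> x, - w \<bullet> x] :: real^2) ` uminus ` S)"
    using det d by (intro planar_area_eq) auto
  also have "\<dots> = planar_area S"
    unfolding d image_image using planar_area_eq[OF S det] by simp
  finally show ?thesis .
qed

text \<open>The enumeration of the four indices is a parameter, so one facet computation transfers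
  to all facets of its kind by reinterpretation with permuted indices.\<close>

locale obtuse_superbase_3d = obtuse_superbase I b
  for I :: "'i set" and b :: "'i \<Rightarrow> real^3" and i j k l :: 'i +
  assumes index_eq: "I = {i, j, k, l}"
    and distinct: "i \<noteq> j" "i \<noteq> k" "i \<noteq> l" "j \<noteq> k" "j \<noteq> l" "k \<noteq> l"
    and det_nonzero: "det (vector [b i, b j, b k] :: real^3^3) \<noteq> 0"
begin

definition sel :: "'i \<Rightarrow> 'i \<Rightarrow> real" where
  "sel m n = - (b m \<bullet> b n)"

lemma sel_pos: "0 < sel i j" "0 < sel i k" "0 < sel i l" "0 < sel j k" "0 < sel j l" "0 < sel k l"
  using obtuse distinct unfolding sel_def index_eq by simp_all

lemma last_eq: "b l = - (b i + b j + b k)"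
  using sum_eq_0 distinct unfolding index_eq by (simp add: add_eq_0_iff2 add.assoc add.commute)

lemma inner_last: "b l \<bullet> x = - (b i \<bullet> x) - b j \<bullet> x - b k \<bullet> x"
  by (simp add: last_eq inner_add_left inner_diff_left)

lemma inner_self:
  "b i \<bullet> b i = sel i j + sel i k + sel i l"
  "b j \<bullet> b j = sel i j + sel j k + sel j l"
  "b k \<bullet> b k = sel i k + sel j k + sel k l"
  "b l \<bullet> b l = sel i l + sel j l + sel k l"
  unfolding sel_def last_eq
  by (simp_all add: inner_add_left inner_add_right inner_diff_left inner_diff_right inner_commute)

lemma inner_distinct:
  "b i \<bullet> b j = - sel i j" "b i \<bullet> b k = - sel i k" "b i \<bullet> b l = - sel i l"
  "b j \<bullet> b k = - sel j k" "b j \<bullet> b l = - sel j l" "b k \<bullet> b l = - sel k l"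
  "b j \<bullet> b i = - sel i j" "b k \<bullet> b i = - sel i k" "b l \<bullet> b i = - sel i l"
  "b k \<bullet> b j = - sel j k" "b l \<bullet> b j = - sel j l" "b l \<bullet> b k = - sel k l"
  by (simp_all add: sel_def inner_commute)

text \<open>The empty and the full index set contribute only \<open>0 \<le> 0\<close>; including
  them allows a plain enumeration of the power set.\<close>

lemma mem_cell_iff_Pow: "x \<in> cell \<longleftrightarrow> (\<forall>T\<in>Pow I. 2 * (sum b T \<bullet> x) \<le> sum b T \<bullet> sum b T)"
proof -
  have "2 * (sum b T \<bullet> x) \<le> sum b T \<bullet> sum b T" if "T = {} \<or> T = I" for T
    using that by (auto simp: sum_eq_0)
  moreover have "2 * (sum b T \<bullet> x) \<le> sum b T \<bullet> sum b T \<longleftrightarrow> sum b T \<bullet> x \<le> sum b T \<bullet> sum b T / 2" for T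
    by auto
  ultimately show ?thesis unfolding cell_def by blast
qed

text \<open>Complementary index sets have opposite sums, so the fourteen inequalities combine to
  seven bounds on absolute values.\<close>

lemma mem_cell_iff: "x \<in> cell \<longleftrightarrow>
    2 * \<bar>b i \<bullet> x\<bar> \<le> sel i j + sel i k + sel i l \<and> 2 * \<bar>b j \<bullet> x\<bar> \<le> sel i j + sel j k + sel j l
    \<and> 2 * \<bar>b k \<bullet> x\<bar> \<le> sel i k + sel j k + sel k l \<and> 2 * \<bar>b l \<bullet> x\<bar> \<le> sel i l + sel j l + sel k l
    \<and> 2 * \<bar>b i \<bullet> x + b j \<bullet> x\<bar> \<le> sel i k + sel i l + sel j k + sel j l
    \<and> 2 * \<bar>b i \<bullet> x + b k \<bullet> x\<bar> \<le> sel i j + sel i l + sel j k + sel k l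
    \<and> 2 * \<bar>b i \<bullet> x + b l \<bullet> x\<bar> \<le> sel i j + sel i k + sel j l + sel k l"
proof -
  have P: "(\<forall>T\<in>Pow I. Q T) \<longleftrightarrow> Q {} \<and> Q {i} \<and> Q {j} \<and> Q {k} \<and> Q {l} \<and> Q {i,j} \<and> Q {i,k} \<and> Q {i,l}
      \<and> Q {j,k} \<and> Q {j,l} \<and> Q {k,l} \<and> Q {i,j,k} \<and> Q {i,j,l} \<and> Q {i,k,l} \<and> Q {j,k,l} \<and> Q {i,j,k,l}" for Q
    unfolding index_eq by (auto simp: Pow_insert)
  show ?thesis
    unfolding mem_cell_iff_Pow P double_abs_le_iff using distinct
    by (simp add: inner_add_left inner_add_right inner_self inner_distinct)
       (unfold inner_last, intro iffI; elim conjE; intro conjI; simp add: algebra_simps)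
qed

lemma closed_cell: "closed cell"
proof -
  have "cell = (\<Inter>v\<in>sum b ` (Pow I - {{}, I}). {x. v \<bullet> x \<le> v \<bullet> v / 2})"
    by (auto simp: cell_def)
  moreover have "closed {x. v \<bullet> x \<le> v \<bullet> v / 2}" for v :: "real^3"
    by (rule closed_halfspace_le)
  ultimately show ?thesis by auto
qed

lemma uminus_mem_cell: "x \<in> cell \<Longrightarrow> - x \<in> cell"
proof -
  have "\<bar>- s - t\<bar> = \<bar>s + t\<bar>" for s t :: real by linarith
  then show "x \<in> cell \<Longrightarrow> - x \<in> cell" unfolding mem_cell_iff by simp
qed

abbreviation facet :: "real^3 \<Rightarrow> (real^3) set" where
  "facet v \<equiv> cell \<inter> {x. v \<bullet> x = v \<bullet> v / 2}"

lemma facet_uminus: "facet (- v) = uminus ` facet v"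
proof
  show "facet (- v) \<subseteq> uminus ` facet v"
  proof
    fix x assume "x \<in> facet (- v)"
    then have "- x \<in> facet v" using uminus_mem_cell by auto
    then show "x \<in> uminus ` facet v" by (metis image_eqI minus_minus)
  qed
  show "uminus ` facet v \<subseteq> facet (- v)" using uminus_mem_cell by auto
qed

lemma bounded_cell: "bounded cell"
proof (rule bounded_if_inner_bounded[OF det_nonzero])
  fix x assume "x \<in> cell"
  then show "\<bar>b i \<bullet> x\<bar> \<le> sel i j + sel i k + sel i l + sel j k + sel j l + sel k l
      \<and> \<bar>b j \<bullet> x\<bar> \<le> sel i j + sel i k + sel i l + sel j k + sel j l + sel k l
      \<and> \<bar>b k \<bullet> x\<bar> \<le> sel i j + sel i k + sel i l + sel j k + sel j l + sel k l"
    unfolding mem_cell_iff using sel_pos by simp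
qed

lemma compact_facet: "compact (facet v)"
  unfolding compact_eq_bounded_closed
  using bounded_cell closed_cell closed_hyperplane[of v "v \<bullet> v / 2"] by blast

lemma bisector_vectors:
  defines "V \<equiv> sum b ` (Pow I - {{}, I})"
  shows "finite V" "0 \<notin> V" "v \<in> V \<Longrightarrow> w \<in> V \<Longrightarrow> v \<noteq> w \<Longrightarrow> w \<bullet> v < w \<bullet> w"
proof -
  show "finite V" using finite_index by (simp add: V_def)
  show "w \<bullet> v < w \<bullet> w" if vw: "v \<in> V" "w \<in> V" "v \<noteq> w"
  proof -
    obtain S T where "S \<subseteq> I" "T \<subset> I" "T \<noteq> {}" "v = sum b S" "w = sum b T"
      using vw unfolding V_def by blast
    then show ?thesis using inner_sum_less[of S T] vw(3) by blast
  qed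
  show "0 \<notin> V"
  proof
    assume "0 \<in> V"
    then obtain T where "T \<subset> I" "T \<noteq> {}" "0 = sum b T" unfolding V_def by blast
    then show False using inner_sum_subset_pos[of T T] by simp
  qed
qed

lemma aff_dim_facet: "v \<in> sum b ` (Pow I - {{}, I}) \<Longrightarrow> aff_dim (facet v) = 2"
  unfolding cell_def by (rule surface_area_bisector_polytope(2)[OF bisector_vectors])

lemma surface_area_cell: "surface_area cell = (\<Sum>T\<in>Pow I - {{}, I}. planar_area (facet (sum b T)))"
proof -
  have "surface_area cell = (\<Sum>v\<in>sum b ` (Pow I - {{}, I}). planar_area (facet v))"
    unfolding cell_def by (rule surface_area_bisector_polytope(1)[OF bisector_vectors])
  then show ?thesis using inj_on_sum by (simp add: sum.reindex)
qed

text \<open>In the coordinates \<open>b j \<bullet> x\<close> and \<open>b k \<bullet> x\<close> the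
  facet is a hexagon centred at the image of \<open>b i / 2\<close>. Each of its three strips comes
  from one of \<open>j\<close>, \<open>k\<close>, \<open>l\<close>: one side is the inequality of
  that vector, the other the inequality of its sum with \<open>b i\<close>, in which
  \<open>b i \<bullet> x\<close> is now fixed.\<close>

lemma planar_area_facet_single:
  "planar_area (facet (b i)) = norm (b i) / \<bar>det (vector [b i, b j, b k] :: real^3^3)\<bar>
    * (sel j k * sel j l + sel j k * sel k l + sel j l * sel k l)"
  "planar_area (facet (- b i)) = planar_area (facet (b i))"
proof -
  have "b i = sum b {i}" "{i} \<in> Pow I - {{}, I}" using distinct by (auto simp: index_eq)
  then have "aff_dim (facet (b i)) = 2" by (metis aff_dim_facet imageI)
  note args = compact_facet[of "b i"] Int_lower2 this det_nonzero
  show "planar_area (facet (- b i)) = planar_area (facet (b i))"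
    unfolding facet_uminus by (rule planar_area_uminus[OF args])
  let ?H = "{z :: real^2. \<bar>z$1\<bar> \<le> (sel j k + sel j l)/2 \<and> \<bar>z$2\<bar> \<le> (sel j k + sel k l)/2
    \<and> \<bar>z$1 + z$2\<bar> \<le> (sel j l + sel k l)/2}"
  have "(\<lambda>x. vector [b j \<bullet> x, b k \<bullet> x] :: real^2) ` facet (b i)
      = (+) (vector [- sel i j / 2, - sel i k / 2]) ` ?H" (is "?L = ?R")
  proof
    show "?L \<subseteq> ?R"
    proof
      fix z assume "z \<in> ?L"
      then obtain x where x: "x \<in> cell" "2 * (b i \<bullet> x) = sel i j + sel i k + sel i l"
          "z = vector [b j \<bullet> x, b k \<bullet> x]"
        by (auto simp: inner_self)
      have "z = vector [- sel i j / 2, - sel i k / 2] + vector [b j \<bullet> x + sel i j / 2, b k \<bullet> x + sel i k / 2]"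
        by (simp add: x(3) vec_eq_iff forall_2)
      moreover have "vector [b j \<bullet> x + sel i j / 2, b k \<bullet> x + sel i k / 2] \<in> ?H"
        using x(1,2) unfolding mem_cell_iff inner_last mem_Collect_eq vector_2 abs_le_half_iff double_abs_le_iff
        by (intro conjI) argo+
      ultimately show "z \<in> ?R" by blast
    qed
    show "?R \<subseteq> ?L"
    proof
      fix z assume "z \<in> ?R"
      then obtain y where y: "y \<in> ?H" "z = vector [- sel i j / 2, - sel i k / 2] + y" by blast
      obtain x where x: "b i \<bullet> x = (sel i j + sel i k + sel i l) / 2"
          "b j \<bullet> x = y$1 - sel i j / 2" "b k \<bullet> x = y$2 - sel i k / 2"
        using inner_eqs_solvable[OF det_nonzero] by metis
      have "z = vector [b j \<bullet> x, b k \<bullet> x]" by (simp add: x y(2) vec_eq_iff forall_2)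
      moreover have "x \<in> cell"
        using y(1) sel_pos
        unfolding mem_cell_iff inner_last x mem_Collect_eq abs_le_half_iff double_abs_le_iff
        by (intro conjI) argo+
      moreover have "b i \<bullet> x = b i \<bullet> b i / 2" by (simp add: x inner_self)
      ultimately show "z \<in> ?L" by blast
    qed
  qed
  then show "planar_area (facet (b i)) = norm (b i) / \<bar>det (vector [b i, b j, b k] :: real^3^3)\<bar>
    * (sel j k * sel j l + sel j k * sel k l + sel j l * sel k l)"
    unfolding planar_area_eq[OF args]
    by (simp only: measure_translation measure_hexagon[OF sel_pos(4-6)])
qed

text \<open>On this facet the sum of \<open>b i \<bullet> x\<close> and
  \<open>b j \<bullet> x\<close> is fixed, so their upper bounds confine
  \<open>b i \<bullet> x\<close> to an interval of length \<open>sel i j\<close>. The lower bounds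
  for \<open>b k\<close> and \<open>b l\<close> similarly confine \<open>b k \<bullet> x\<close> to
  length \<open>sel k l\<close>, which makes a rectangle.\<close>

lemma planar_area_facet_pair:
  "planar_area (facet (b i + b j)) = norm (b i + b j) / \<bar>det (vector [b i, b j, b k] :: real^3^3)\<bar>
    * (sel i j * sel k l)"
  "planar_area (facet (- (b i + b j))) = planar_area (facet (b i + b j))"
proof -
  have "b i + b j = sum b {i, j}" "{i, j} \<in> Pow I - {{}, I}" using distinct by (auto simp: index_eq)
  then have dim: "aff_dim (facet (b i + b j)) = 2" by (metis aff_dim_facet imageI)
  have d: "det (vector [b i + b j, b i, b k] :: real^3^3) = - det (vector [b i, b j, b k] :: real^3^3)"
    by (simp add: det_3 algebra_simps)
  with det_nonzero have "det (vector [b i + b j, b i, b k] :: real^3^3) \<noteq> 0" by simp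
  note args = compact_facet[of "b i + b j"] Int_lower2 dim this
  show "planar_area (facet (- (b i + b j))) = planar_area (facet (b i + b j))"
    unfolding facet_uminus by (rule planar_area_uminus[OF args])
  let ?s = "(sel i k + sel i l - sel i j) / 2" and ?t = "- (sel i k + sel j k + sel k l) / 2"
  have self: "(b i + b j) \<bullet> (b i + b j) = sel i k + sel i l + sel j k + sel j l"
    by (simp add: inner_add_left inner_add_right inner_self inner_distinct)
  have "(\<lambda>x. vector [b i \<bullet> x, b k \<bullet> x] :: real^2) ` facet (b i + b j)
      = {z. ?s \<le> z$1 \<and> z$1 \<le> ?s + sel i j \<and> ?t \<le> z$2 \<and> z$2 \<le> ?t + sel k l}" (is "?L = ?R")
  proof
    show "?L \<subseteq> ?R"
    proof
      fix z assume "z \<in> ?L"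
      then obtain x where x: "x \<in> cell" "(b i + b j) \<bullet> x = (b i + b j) \<bullet> (b i + b j) / 2"
          "z = vector [b i \<bullet> x, b k \<bullet> x]"
        by blast
      have "2 * (b i \<bullet> x + b j \<bullet> x) = sel i k + sel i l + sel j k + sel j l"
        using x(2) unfolding self unfolding inner_add_left by simp
      then show "z \<in> ?R"
        using x(1) unfolding mem_cell_iff inner_last x(3) mem_Collect_eq vector_2 double_abs_le_iff
        by (intro conjI) argo+
    qed
    show "?R \<subseteq> ?L"
    proof
      fix z assume z: "z \<in> ?R"
      obtain x where x: "b i \<bullet> x = z$1" "b j \<bullet> x = (sel i k + sel i l + sel j k + sel j l) / 2 - z$1"
          "b k \<bullet> x = z$2"
        using inner_eqs_solvable[OF det_nonzero] by metis
      have "z = vector [b i \<bullet> x, b k \<bullet> x]" by (simp add: x vec_eq_iff forall_2)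
      moreover have "x \<in> cell"
        using z sel_pos unfolding mem_cell_iff inner_last x mem_Collect_eq double_abs_le_iff
        by (intro conjI) argo+
      moreover have "(b i + b j) \<bullet> x = (b i + b j) \<bullet> (b i + b j) / 2"
        unfolding self unfolding inner_add_left x by simp
      ultimately show "z \<in> ?L" by blast
    qed
  qed
  moreover have "measure lebesgue ?R = sel i j * sel k l"
    using sel_pos by (intro measure_rectangle) auto
  ultimately show "planar_area (facet (b i + b j))
      = norm (b i + b j) / \<bar>det (vector [b i, b j, b k] :: real^3^3)\<bar> * (sel i j * sel k l)"
    unfolding planar_area_eq[OF args] d by (simp only: abs_minus_cancel)
qed

lemma sum_proper_subsets:
  fixes g :: "'i set \<Rightarrow> real"
  shows "(\<Sum>T\<in>Pow I - {{}, I}. g T) = g {i} + g {j} + g {k} + g {l} + g {i,j} + g {k,l} + g {i,k} + g {j,l}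
    + g {i,l} + g {j,k} + g {j,k,l} + g {i,k,l} + g {i,j,l} + g {i,j,k}"
proof -
  have ins: "sum g (Pow (insert a A)) = sum g (Pow A) + (\<Sum>T\<in>Pow A. g (insert a T))"
    if "finite A" "a \<notin> A" for g :: "'i set \<Rightarrow> real" and a A
  proof -
    have "inj_on (insert a) (Pow A)" using that(2) by (intro inj_onI) (metis Pow_iff insert_ident subsetD)
    moreover have "Pow A \<inter> insert a ` Pow A = {}" using that(2) by blast
    ultimately show ?thesis
      using that(1) by (simp add: Pow_insert sum.union_disjoint sum.reindex)
  qed
  have "{} \<noteq> I" by (simp add: index_eq)
  then have "(\<Sum>T\<in>Pow I - {{}, I}. g T) = sum g (Pow I) - (g {} + g I)"
    using finite_index by (subst sum_diff) auto
  also have "\<dots> = g {i} + g {j} + g {k} + g {l} + g {i,j} + g {k,l} + g {i,k} + g {j,l}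
    + g {i,l} + g {j,k} + g {j,k,l} + g {i,k,l} + g {i,j,l} + g {i,j,k}"
    unfolding index_eq using distinct by (simp add: ins)
  finally show ?thesis .
qed

lemma sel_commute: "sel m n = sel n m"
  by (simp add: sel_def inner_commute)

lemma norm_eq:
  "norm (b i) = sqrt (sel i j + sel i k + sel i l)"
  "norm (b i + b j) = sqrt (sel i k + sel i l + sel j k + sel j l)"
  unfolding norm_eq_sqrt_inner
  by (simp_all add: inner_add_left inner_add_right inner_self inner_distinct)

text \<open>Permuted interpretations give the other facets; the determinants involved differ only in
  sign because the four vectors sum to 0. Antipodal facets have equal area, hence the factor 2. The
  hexagons yield the vertex terms and the rectangles the terms of opposite pairs.\<close>

theorem surface_area_cell_eq:
  "surface_area cell = 2 / \<bar>det (vector [b i, b j, b k] :: real^3^3)\<bar>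
    * area_sum (sel i l) (sel j l) (sel k l) (sel i j) (sel i k) (sel j k)"
proof -
  have d: "det (vector [b j, b i, b k] :: real^3^3) = - det (vector [b i, b j, b k] :: real^3^3)"
    "det (vector [b k, b j, b i] :: real^3^3) = - det (vector [b i, b j, b k] :: real^3^3)"
    "det (vector [b l, b j, b k] :: real^3^3) = - det (vector [b i, b j, b k] :: real^3^3)"
    "det (vector [b i, b k, b j] :: real^3^3) = - det (vector [b i, b j, b k] :: real^3^3)"
    "det (vector [b i, b l, b k] :: real^3^3) = - det (vector [b i, b j, b k] :: real^3^3)"
    by (simp_all add: det_3 last_eq algebra_simps)
  have perm: "obtuse_superbase_3d I b i' j' k' l'"
    if "det (vector [b i', b j', b k'] :: real^3^3) = - det (vector [b i, b j, b k] :: real^3^3)"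
      "I = {i', j', k', l'}" "i' \<noteq> j'" "i' \<noteq> k'" "i' \<noteq> l'" "j' \<noteq> k'" "j' \<noteq> l'" "k' \<noteq> l'" for i' j' k' l'
    by unfold_locales (use that det_nonzero in auto)
  interpret j: obtuse_superbase_3d I b j i k l by (rule perm[OF d(1)]) (use distinct in \<open>auto simp: index_eq\<close>)
  interpret k: obtuse_superbase_3d I b k j i l by (rule perm[OF d(2)]) (use distinct in \<open>auto simp: index_eq\<close>)
  interpret l: obtuse_superbase_3d I b l j k i by (rule perm[OF d(3)]) (use distinct in \<open>auto simp: index_eq\<close>)
  interpret ik: obtuse_superbase_3d I b i k j l by (rule perm[OF d(4)]) (use distinct in \<open>auto simp: index_eq\<close>)
  interpret il: obtuse_superbase_3d I b i l k j by (rule perm[OF d(5)]) (use distinct in \<open>auto simp: index_eq\<close>)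
  have sums: "sum b {k, l} = - (b i + b j)" "sum b {j, l} = - (b i + b k)" "sum b {j, k} = - (b i + b l)"
      "sum b {j, k, l} = - b i" "sum b {i, k, l} = - b j" "sum b {i, j, l} = - b k" "sum b {i, j, k} = - b l"
      "sum b {i, j} = b i + b j" "sum b {i, k} = b i + b k" "sum b {i, l} = b i + b l"
      "sum b {i} = b i" "sum b {j} = b j" "sum b {k} = b k" "sum b {l} = b l"
    using distinct by (simp_all add: last_eq)
  show ?thesis
    unfolding surface_area_cell sum_proper_subsets sums
      planar_area_facet_single j.planar_area_facet_single k.planar_area_facet_single l.planar_area_facet_single
      planar_area_facet_pair ik.planar_area_facet_pair il.planar_area_facet_pair
      norm_eq j.norm_eq k.norm_eq l.norm_eq ik.norm_eq il.norm_eq d abs_minus_cancel area_sum_def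
      sel_commute[of j i] sel_commute[of k i] sel_commute[of l i] sel_commute[of k j] sel_commute[of l j] sel_commute[of l k]
    by (simp add: add_divide_distrib algebra_simps)
qed

end

text \<open>Points of \<open>cell\<close> satisfy all lattice inequalities by
  \<open>cell_bound_int\<close>. Conversely, each partial sum is a lattice vector, with the
  indicator function of its index set as coefficients.\<close>

lemma (in obtuse_superbase_3d) voronoi_cell_eq_cell:
  "voronoi_cell (range (\<lambda>m :: 'i \<Rightarrow> int. \<Sum>i\<in>I. of_int (m i) *\<^sub>R b i)) = cell"
  (is "voronoi_cell (range ?v) = cell")
proof (intro set_eqI iffI)
  fix x assume "x \<in> cell"
  then show "x \<in> voronoi_cell (range ?v)"
    unfolding mem_voronoi_cell_iff using cell_bound_int by blast
next
  fix x assume x: "x \<in> voronoi_cell (range ?v)"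
  have "sum b T \<bullet> x \<le> sum b T \<bullet> sum b T / 2" if "T \<subseteq> I" for T
  proof -
    have "?v (\<lambda>i. if i \<in> T then 1 else 0) = (\<Sum>i\<in>I. if i \<in> T then b i else 0)"
      by (intro sum.cong) auto
    also have "\<dots> = sum b (I \<inter> T)"
      using finite_index by (rule sum.inter_restrict[symmetric])
    also have "I \<inter> T = T" using that by blast
    finally have "sum b T \<in> range ?v"
      by (intro range_eqI[of _ _ "\<lambda>i. if i \<in> T then 1 else 0"]) (rule sym)
    then show ?thesis using x unfolding mem_voronoi_cell_iff by blast
  qed
  then show "x \<in> cell" unfolding cell_def by blast
qed

section \<open>From Selling parameters to the area of the Voronoi cell\<close>

lemma gram_matrix_exists:
  fixes p q r x y z :: real
  assumes "0 < p" "0 < p*q - x\<^sup>2" "0 < p*q*r + 2*x*y*z - p*z\<^sup>2 - q*y\<^sup>2 - r*x\<^sup>2"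
  shows "\<exists>B. gram_matrix B = vector [vector [p, x, y], vector [x, q, z], vector [y, z, r]]"
proof -
  \<comment> \<open>Cholesky factorisation: the diagonal entries \<open>s\<close>,
    \<open>t/s\<close> and \<open>u\<close> are the square roots of the quotients of successive
    leading minors, which are positive by assumption.\<close>
  define s where "s = sqrt p"
  define t where "t = sqrt (p*q - x\<^sup>2)"
  define u where "u = sqrt (p*q*r + 2*x*y*z - p*z\<^sup>2 - q*y\<^sup>2 - r*x\<^sup>2) / t"
  have nz: "s \<noteq> 0" "t \<noteq> 0" using assms by (simp_all add: s_def t_def)
  have s: "s * s = p" and t: "t * t = p*q - x\<^sup>2"
    using assms by (simp_all add: s_def t_def)
  have u: "u * u = (p*q*r + 2*x*y*z - p*z\<^sup>2 - q*y\<^sup>2 - r*x\<^sup>2) / (t * t)"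
    using assms by (simp add: u_def)
  let ?w = "(s * s * z - x*y) / (s * t)"
  let ?B = "vector [vector [s, 0, 0], vector [x/s, t/s, 0], vector [y/s, ?w, u]] :: real^3^3"
  have q: "x/s * (x/s) + t/s * (t/s) = q"
  proof -
    have "x * x + t * t = q * (s * s)" unfolding s t by (simp add: power2_eq_square)
    then show ?thesis using nz by (simp add: field_simps)
  qed
  have z: "x/s * (y/s) + t/s * ?w = z" using nz by (simp add: field_simps)
  have r: "y/s * (y/s) + ?w * ?w + u * u = r"
  proof -
    have "y * y * (t * t) + (s * s * z - x*y) * (s * s * z - x*y)
        + (p*q*r + 2*x*y*z - p*z\<^sup>2 - q*y\<^sup>2 - r*x\<^sup>2) * (s * s) = r * ((s * s) * (t * t))"
      unfolding s t by (simp add: power2_eq_square algebra_simps)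
    then have "(y * y * (t * t) + (s * s * z - x*y) * (s * s * z - x*y)
        + (p*q*r + 2*x*y*z - p*z\<^sup>2 - q*y\<^sup>2 - r*x\<^sup>2) * (s * s)) / ((s * s) * (t * t)) = r"
      using nz by simp
    moreover have "y/s * (y/s) + ?w * ?w + c / (t * t)
        = (y * y * (t * t) + (s * s * z - x*y) * (s * s * z - x*y) + c * (s * s)) / ((s * s) * (t * t))" for c
      using nz by (simp add: add_divide_distrib)
    ultimately show ?thesis unfolding u by simp
  qed
  have "gram_matrix ?B = vector [vector [p, x, y], vector [x, q, z], vector [y, z, r]]"
    unfolding gram_matrix_def vec_eq_iff forall_3
    using nz q z r s by (simp add: inner_vec_def sum_3 mult.commute[of y x])
  then show ?thesis by blast
qed

lemma exhaust_6: "n = 1 \<or> n = 2 \<or> n = 3 \<or> n = 4 \<or> n = 5 \<or> n = 6" for n :: 6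
proof (induct n)
  case (of_int z)
  then have "0 \<le> z" "z < 6" by simp_all
  then have "z = 0 \<or> z = 1 \<or> z = 2 \<or> z = 3 \<or> z = 4 \<or> z = 5" by arith
  then show ?case by auto
qed

lemma det_selling_matrix:
  "det (selling_matrix \<rho>) = selling_det (\<rho>$1) (\<rho>$2) (\<rho>$3) (\<rho>$4) (\<rho>$5) (\<rho>$6)"
  by (simp add: selling_matrix_def Let_def det_3 selling_det_def power2_eq_square algebra_simps)

text \<open>The numbering follows the Selling parameters, with index 0 for the dependent vector.
  Below it is listed last, in the role of \<open>l\<close>.\<close>

definition superbase :: "real^3^3 \<Rightarrow> nat \<Rightarrow> real^3" where
  "superbase B n = (if n = 0 then - (B$1 + B$2 + B$3) else if n = 1 then B$1 else if n = 2 then B$2 else B$3)"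

lemma superbase_simps [simp]:
  "superbase B 0 = - (B$1 + B$2 + B$3)" "superbase B 1 = B$1" "superbase B (Suc 0) = B$1"
  "superbase B 2 = B$2" "superbase B 3 = B$3"
  by (simp_all add: superbase_def)

lemma lattice_of_superbase:
  "lattice_of B = range (\<lambda>m :: nat \<Rightarrow> int. \<Sum>n\<in>{1, 2, 3, 0}. of_int (m n) *\<^sub>R superbase B n)"
proof
  show "lattice_of B \<subseteq> range (\<lambda>m :: nat \<Rightarrow> int. \<Sum>n\<in>{1, 2, 3, 0}. of_int (m n) *\<^sub>R superbase B n)"
  proof
    fix v assume "v \<in> lattice_of B"
    then obtain z :: "3 \<Rightarrow> int" where z: "v = (\<Sum>i\<in>UNIV. of_int (z i) *\<^sub>R B$i)"
      by (auto simp: lattice_of_def)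
    define m :: "nat \<Rightarrow> int" where "m n = (if n = 0 then 0 else if n = 1 then z 1 else if n = 2 then z 2 else z 3)" for n
    have "v = (\<Sum>n\<in>{1, 2, 3, 0}. of_int (m n) *\<^sub>R superbase B n)"
      by (simp add: z m_def sum_3)
    then show "v \<in> range (\<lambda>m :: nat \<Rightarrow> int. \<Sum>n\<in>{1, 2, 3, 0}. of_int (m n) *\<^sub>R superbase B n)" by blast
  qed
  show "range (\<lambda>m :: nat \<Rightarrow> int. \<Sum>n\<in>{1, 2, 3, 0}. of_int (m n) *\<^sub>R superbase B n) \<subseteq> lattice_of B"
  proof
    fix v assume "v \<in> range (\<lambda>m :: nat \<Rightarrow> int. \<Sum>n\<in>{1, 2, 3, 0}. of_int (m n) *\<^sub>R superbase B n)"
    then obtain m :: "nat \<Rightarrow> int" where m: "v = (\<Sum>n\<in>{1, 2, 3, 0}. of_int (m n) *\<^sub>R superbase B n)" by blast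
    \<comment> \<open>The coefficient \<open>m 0\<close> of the dependent vector is subtracted from
      the other three.\<close>
    define z :: "3 \<Rightarrow> int" where "z i = (if i = 1 then m 1 else if i = 2 then m 2 else m 3) - m 0" for i
    have "v = (\<Sum>i\<in>UNIV. of_int (z i) *\<^sub>R B$i)"
      by (simp add: m z_def sum_3 algebra_simps)
    then show "v \<in> lattice_of B" by (auto simp: lattice_of_def)
  qed
qed

text \<open>Positive parameters make the leading minors sums of positive monomials, so a basis with
  the prescribed Gram matrix exists. Its superbase has the inner products \<open>- \<rho>$n\<close>,
  hence is strictly obtuse, and the facet computation applies.\<close>

lemma voronoi_area_eq:
  fixes \<rho> :: "real^6"
  assumes pos: "\<And>n. 0 < \<rho>$n"
  shows "voronoi_area \<rho> = 2 / sqrt (det (selling_matrix \<rho>)) * area_sum (\<rho>$1) (\<rho>$2) (\<rho>$3) (\<rho>$4) (\<rho>$5) (\<rho>$6)"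
proof -
  let ?a = "\<rho>$1" and ?b = "\<rho>$2" and ?c = "\<rho>$3" and ?d = "\<rho>$4" and ?e = "\<rho>$5" and ?f = "\<rho>$6"
  let ?S = "selling_matrix \<rho>"
  have S: "?S = vector [vector [?a + ?d + ?e, - ?d, - ?e], vector [- ?d, ?b + ?d + ?f, - ?f],
      vector [- ?e, - ?f, ?c + ?e + ?f]]"
    by (simp add: selling_matrix_def Let_def)
  have "det ?S = ?a*?b*?c + ?a*?b*?e + ?a*?b*?f + ?a*?c*?d + ?a*?c*?f + ?a*?d*?e + ?a*?d*?f + ?a*?e*?f
      + ?b*?c*?d + ?b*?c*?e + ?b*?d*?e + ?b*?d*?f + ?b*?e*?f + ?c*?d*?e + ?c*?d*?f + ?c*?e*?f"
    by (simp add: det_selling_matrix selling_det_def power2_eq_square algebra_simps)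
  then have det_pos: "0 < det ?S"
    using pos by (simp add: add_pos_pos)
  have "\<exists>B. gram_matrix B = ?S"
    unfolding S
  proof (rule gram_matrix_exists)
    show "0 < ?a + ?d + ?e" using pos by (simp add: add_pos_pos)
    have "(?a + ?d + ?e) * (?b + ?d + ?f) - (- ?d)\<^sup>2 = ?a * (?b + ?d + ?f) + ?d * (?b + ?f) + ?e * (?b + ?d + ?f)"
      by (simp add: power2_eq_square algebra_simps)
    then show "0 < (?a + ?d + ?e) * (?b + ?d + ?f) - (- ?d)\<^sup>2"
      using pos by (simp add: add_pos_pos)
    show "0 < (?a + ?d + ?e) * (?b + ?d + ?f) * (?c + ?e + ?f) + 2 * - ?d * - ?e * - ?f
        - (?a + ?d + ?e) * (- ?f)\<^sup>2 - (?b + ?d + ?f) * (- ?e)\<^sup>2 - (?c + ?e + ?f) * (- ?d)\<^sup>2"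
      using det_pos unfolding S by (simp add: det_3 power2_eq_square algebra_simps)
  qed
  define B where "B = (SOME B. gram_matrix B = ?S)"
  have B: "gram_matrix B = ?S"
    unfolding B_def by (rule someI_ex) fact
  have "B$m \<bullet> B$n = ?S $ m $ n" for m n
    unfolding B[symmetric] by (simp add: gram_matrix_def)
  then have ip: "B$1 \<bullet> B$1 = ?a + ?d + ?e" "B$1 \<bullet> B$2 = - ?d" "B$1 \<bullet> B$3 = - ?e"
      "B$2 \<bullet> B$1 = - ?d" "B$2 \<bullet> B$2 = ?b + ?d + ?f" "B$2 \<bullet> B$3 = - ?f"
      "B$3 \<bullet> B$1 = - ?e" "B$3 \<bullet> B$2 = - ?f" "B$3 \<bullet> B$3 = ?c + ?e + ?f"
    unfolding S by simp_all
  have rows: "vector [B$1, B$2, B$3] = B" by (simp add: vec_eq_iff forall_3)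
  \<comment> \<open>The Gram determinant is the square of \<open>det B\<close>, which turns the
    determinant in the area formula into \<open>sqrt (det ?S)\<close>.\<close>
  have "gram_matrix B = B ** transpose B"
    by (simp add: gram_matrix_def vec_eq_iff matrix_matrix_mult_def transpose_def inner_vec_def)
  then have "(det B)\<^sup>2 = det ?S"
    unfolding B by (simp add: det_mul power2_eq_square)
  then have det_B: "\<bar>det B\<bar> = sqrt (det ?S)" by (metis real_sqrt_abs)
  have products: "superbase B 1 \<bullet> superbase B 0 = - ?a" "superbase B 2 \<bullet> superbase B 0 = - ?b"
      "superbase B 3 \<bullet> superbase B 0 = - ?c" "superbase B 1 \<bullet> superbase B 2 = - ?d"
      "superbase B 1 \<bullet> superbase B 3 = - ?e" "superbase B 2 \<bullet> superbase B 3 = - ?f"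
    by (simp_all add: inner_add_right inner_diff_right ip)
  interpret obtuse_superbase_3d "{1, 2, 3, 0}" "superbase B" 1 2 3 0
  proof
    show "finite {1, 2, 3, 0 :: nat}" by simp
    show "sum (superbase B) {1, 2, 3, 0} = 0" by simp
    show "det (vector [superbase B 1, superbase B 2, superbase B 3] :: real^3^3) \<noteq> 0"
      using det_B det_pos rows by auto
    show "superbase B m \<bullet> superbase B n < 0" if "m \<in> {1, 2, 3, 0}" "n \<in> {1, 2, 3, 0}" "m \<noteq> n" for m n
    proof -
      have neg: "superbase B 1 \<bullet> superbase B 0 < 0" "superbase B 2 \<bullet> superbase B 0 < 0"
          "superbase B 3 \<bullet> superbase B 0 < 0" "superbase B 1 \<bullet> superbase B 2 < 0"
          "superbase B 1 \<bullet> superbase B 3 < 0" "superbase B 2 \<bullet> superbase B 3 < 0"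
        unfolding products using pos by simp_all
      define c where "c = superbase B"
      from neg have "c 1 \<bullet> c 0 < 0" "c 2 \<bullet> c 0 < 0" "c 3 \<bullet> c 0 < 0" "c 1 \<bullet> c 2 < 0" "c 1 \<bullet> c 3 < 0" "c 2 \<bullet> c 3 < 0"
          "c 0 \<bullet> c 1 < 0" "c 0 \<bullet> c 2 < 0" "c 0 \<bullet> c 3 < 0" "c 2 \<bullet> c 1 < 0" "c 3 \<bullet> c 1 < 0" "c 3 \<bullet> c 2 < 0"
        unfolding c_def by (simp_all only: inner_commute)
      then have "c m \<bullet> c n < 0" using that by fastforce
      then show ?thesis by (simp only: c_def)
    qed
  qed simp_all
  have "voronoi_area \<rho> = surface_area (voronoi_cell (lattice_of B))"
    by (simp add: voronoi_area_def selling_lattice_def B_def)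
  also have "\<dots> = surface_area cell"
    unfolding lattice_of_superbase voronoi_cell_eq_cell ..
  also have "\<dots> = 2 / sqrt (det ?S) * area_sum ?a ?b ?c ?d ?e ?f"
    unfolding surface_area_cell_eq sel_def products using det_B rows by simp
  finally show ?thesis .
qed

section \<open>Strict local minimality on the hypersurface of constant determinant\<close>

theorem theorem3p1:
  "det (selling_matrix rho_BCC) = 16 \<and>
   (\<exists>U. open U \<and> rho_BCC \<in> U \<and>
     (\<forall>\<rho> \<in> (U \<inter> same_volume_hypersurface) - {rho_BCC}.
        isoperimetric_quotient \<rho> > isoperimetric_quotient rho_BCC))"
proof (intro conjI exI ballI)
  show det_BCC: "det (selling_matrix rho_BCC) = 16"
    by (simp add: det_selling_matrix selling_det_def rho_BCC_def)
  \<comment> \<open>The radius bounds every coordinate deviation by the 1/1000 of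
    \<open>area_sum_gt\<close> and keeps all parameters positive.\<close>
  let ?U = "ball rho_BCC (1/1000)"
  show "open ?U" "rho_BCC \<in> ?U" by simp_all
  fix \<rho> assume \<rho>: "\<rho> \<in> ?U \<inter> same_volume_hypersurface - {rho_BCC}"
  have near: "\<bar>\<rho>$n - 1\<bar> \<le> 1/1000" for n
  proof -
    have "\<bar>(\<rho> - rho_BCC) $ n\<bar> \<le> norm (\<rho> - rho_BCC)" by (rule component_le_norm_cart)
    also have "\<dots> \<le> 1/1000" using \<rho> by (simp add: dist_norm norm_minus_commute)
    finally show ?thesis by (simp add: rho_BCC_def)
  qed
  have pos: "0 < \<rho>$n" for n using abs_le_D2[OF near[of n]] by simp
  have det: "det (selling_matrix \<rho>) = 16"
    using \<rho> det_BCC by (simp add: same_volume_hypersurface_def)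
  have "\<not> (\<rho>$1 = 1 \<and> \<rho>$2 = 1 \<and> \<rho>$3 = 1 \<and> \<rho>$4 = 1 \<and> \<rho>$5 = 1 \<and> \<rho>$6 = 1)"
  proof
    assume "\<rho>$1 = 1 \<and> \<rho>$2 = 1 \<and> \<rho>$3 = 1 \<and> \<rho>$4 = 1 \<and> \<rho>$5 = 1 \<and> \<rho>$6 = 1"
    then have "\<rho>$n = 1" for n using exhaust_6[of n] by auto
    then have "\<rho> = rho_BCC" by (simp add: rho_BCC_def vec_eq_iff)
    then show False using \<rho> by simp
  qed
  then have "6 + 12 * sqrt 3 < area_sum (\<rho>$1) (\<rho>$2) (\<rho>$3) (\<rho>$4) (\<rho>$5) (\<rho>$6)"
    using det near by (intro area_sum_gt) (simp_all add: det_selling_matrix)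
  \<comment> \<open>Three terms \<open>sqrt 4\<close> and four terms \<open>3 * sqrt 3\<close>.
    Since both determinants are 16, the prefactors agree and comparing \<open>area_sum\<close>
    suffices.\<close>
  moreover have "area_sum 1 1 1 1 1 1 = 6 + 12 * sqrt 3"
    by (simp add: area_sum_def)
  moreover have "voronoi_area rho_BCC = 2 / sqrt 16 * area_sum 1 1 1 1 1 1"
    using voronoi_area_eq[of rho_BCC] unfolding det_BCC by (simp add: rho_BCC_def)
  ultimately have "voronoi_area rho_BCC < voronoi_area \<rho>"
    unfolding voronoi_area_eq[OF pos] det by simp
  then show "isoperimetric_quotient rho_BCC < isoperimetric_quotient \<rho>"
    by (simp add: isoperimetric_quotient_def det det_BCC divide_strict_right_mono)
qed

end
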